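(* For a real number $c>1$ and an even integer $k\ge 6$, define the smoothing of $\mathcal{M}_k(y)$ as $$\mathcal{M}_k^{c}(y):=\frac{\int_1^c \mathcal{M}_k\left(\frac{y}{u}\right)u\,du}{\int_1^c u\,du}.$$ Then $\mathcal{M}_k^{c}$ is continuous on $[0,\infty)$ with $\mathcal{M}_k^{c}(0)=0$, and as $y\to\infty$, $$\mathcal{M}_k^{c}(y)=\frac{1}{2}+O_{k,c}\left(y^{-\frac{1}{12}}\right).$$
   Context: For an even integer $k\ge 2$ and $y>0$, the weight $k$ murmuration density is $$\mathcal{M}_k(y):=\alpha\sqrt{y}\sum_{s\ge1}\sum_{d\ge1}\frac{Q(d)}{s}J_{k-1}\left(\frac{4\pi s\sqrt{y}}{d}\right),$$ extended by $\mathcal{M}_k(0)=0$. Here $J_{k-1}$ is the Bessel function of the first kind of order $k-1$, $$Q(n):=\mu^2(n)\prod_{p\mid n}\frac{p^2}{p^4-2p^2-p+1},\qquad \alpha:=2\pi\prod_{p}\frac{1-p-2p^2+p^4}{p^4-2p^2+p},$$ where $\mu$ is the Möbius function and $p$ runs over primes. $O_{k,c}$ means the implied constant may depend on $k$ and $c$. *)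

theory Defs
  imports
    "HOL-Analysis.Analysis"
    "HOL-Computational_Algebra.Computational_Algebra"
    "HOL-Library.Landau_Symbols"
begin

definition bessel_J :: "nat \<Rightarrow> real \<Rightarrow> real" where
  "bessel_J n x = (\<Sum>m. (-1) ^ m / (fact m * fact (m + n)) * (x / 2) ^ (2 * m + n))"

definition moebius_mu :: "nat \<Rightarrow> int" where
  "moebius_mu n = (if squarefree n then (-1) ^ card (prime_factors n) else 0)"

definition murm_Q :: "nat \<Rightarrow> real" where
  "murm_Q n = real_of_int ((moebius_mu n)\<^sup>2) *
     (\<Prod>p\<in>prime_factors n. real p ^ 2 / (real p ^ 4 - 2 * real p ^ 2 - real p + 1))"

definition murm_alpha :: real where
  "murm_alpha = 2 * pi *
     (\<Prod>p. if prime p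
        then (1 - real p - 2 * real p ^ 2 + real p ^ 4) / (real p ^ 4 - 2 * real p ^ 2 + real p)
        else 1)"

text \<open>The series below start at index 0, so \<open>s\<close> and \<open>d\<close> are shifted by one.
  Only \<open>y \<ge> 0\<close> is meaningful; the value for negative \<open>y\<close> is a dummy.\<close>

definition murm :: "nat \<Rightarrow> real \<Rightarrow> real" where
  "murm k y =
     (if y > 0 then
        murm_alpha * sqrt y *
          (\<Sum>s. \<Sum>d. murm_Q (Suc d) / real (Suc s) *
             bessel_J (k - 1) (4 * pi * real (Suc s) * sqrt y / real (Suc d)))
      else 0)"

definition murm_smooth :: "nat \<Rightarrow> real \<Rightarrow> real \<Rightarrow> real" where
  "murm_smooth k c y =
     integral {1..c} (\<lambda>u. murm k (y / u) * u) / integral {1..c} (\<lambda>u. u)"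

end

theory Submission imports Defs begin

text \<open>
  Smoothing acts inside the double series and replaces \<open>J(z)\<close>, where \<open>J = J\<^sub>k\<^sub>-\<^sub>1\<close>, by
  \<open>H(z) = \<integral>\<^sub>1\<^sup>c \<surd>u J(z / \<surd>u) du\<close>, which together with \<open>H'\<close> is \<open>O(z\<^sup>-\<^sup>3\<^sup>/\<^sup>2)\<close> instead of the
  \<open>O(z\<^sup>-\<^sup>1\<^sup>/\<^sup>2)\<close> valid for \<open>J\<close>; moreover \<open>\<integral>\<^sub>0\<^sup>\<infinity> H = (c\<^sup>2 - 1) / 2 =: I\<close> because
  \<open>\<integral>\<^sub>0\<^sup>\<infinity> J = 1\<close> for odd order.

  Comparing \<open>\<Sum>\<^sub>b b\<^sup>-\<^sup>2 H(Y/b)\<close> termwise with the telescoping increments of the primitive of \<open>H\<close>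
  at the points \<open>Y/b\<close> gives \<open>I/Y + O(Y\<^sup>-\<^sup>7\<^sup>/\<^sup>6)\<close> for all \<open>Y > 0\<close>. Write
  \<open>n\<^sup>2 Q(n) = \<Sum>\<^sub>a\<^sub>|\<^sub>n h(a)\<close> with \<open>h\<close> multiplicative; \<open>h\<close> is essentially supported on squares, so that
  \<open>\<Sum>|h(a)| a\<^sup>-\<^sup>5\<^sup>/\<^sup>6\<close> converges. Hence \<open>\<Sum>\<^sub>d Q(d) H(X/d) = I \<kappa> / X + O(X\<^sup>-\<^sup>7\<^sup>/\<^sup>6)\<close> with
  \<open>\<kappa> = \<Sum> h(a)/a\<close>. Putting \<open>X = 4 \<pi> s \<surd>y\<close> and summing over \<open>s\<close> with weight \<open>\<alpha> \<surd>y / s\<close>, the main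
  term is \<open>\<alpha> \<kappa> \<zeta>(2) / (4 \<pi>)\<close> after division by \<open>I\<close>, which equals \<open>1/2\<close> because the Euler factors
  of \<open>\<alpha> \<kappa> \<zeta>(2) / (2 \<pi>)\<close> cancel; the error is \<open>O(\<surd>y \<cdot> y\<^sup>-\<^sup>7\<^sup>/\<^sup>1\<^sup>2) = O(y\<^sup>-\<^sup>1\<^sup>/\<^sup>1\<^sup>2)\<close>.
\<close>

section \<open>Bessel functions\<close>

text \<open>The entire factor in J_n(x) = (x/2)^n F_n(x^2/4). It isolates a genuine power series in
  \<open>t\<close>, so that termwise differentiation and coefficient comparison apply
  directly.\<close>

definition bessel_entire :: "nat \<Rightarrow> real \<Rightarrow> real" where
  "bessel_entire n t = (\<Sum>m. ((-1) ^ m / (fact m * fact (m + n))) * t ^ m)"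

lemma bessel_entire_summable:
  "summable (\<lambda>m. ((-1) ^ m / (fact m * fact (m + n))) * (t::real) ^ m)"
proof (rule summable_comparison_test'[where N = 0])
  show "summable (\<lambda>m. inverse (fact m) * \<bar>t\<bar> ^ m)" by (rule summable_exp)
next
  fix m :: nat
  have "1 / (fact m * fact (m + n)) \<le> (1 / fact m :: real)"
    by (simp add: field_simps fact_ge_1)
  then have "1 / (fact m * fact (m + n)) * \<bar>t\<bar> ^ m \<le> 1 / fact m * \<bar>t\<bar> ^ m"
    by (intro mult_right_mono) auto
  then show "norm (((-1) ^ m / (fact m * fact (m + n))) * t ^ m) \<le> inverse (fact m) * \<bar>t\<bar> ^ m"
    by (simp add: abs_mult power_abs divide_simps)
qed

lemma bessel_J_eq: "bessel_J n x = (x / 2) ^ n * bessel_entire n (x\<^sup>2 / 4)"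
proof -
  have "(x / 2) ^ (2 * m + n) = (x / 2) ^ n * (x\<^sup>2 / 4) ^ m" for m
    unfolding power_add power_mult power_divide[of x 2 2] by (simp add: mult.commute)
  then have "(-1) ^ m / (fact m * fact (m + n)) * (x / 2) ^ (2 * m + n) =
      (x / 2) ^ n * (((-1) ^ m / (fact m * fact (m + n))) * (x\<^sup>2 / 4) ^ m)" for m
    by simp
  then show ?thesis
    unfolding bessel_J_def bessel_entire_def
    by (simp only: suminf_mult[OF bessel_entire_summable])
qed

lemma has_field_derivative_bessel_entire:
  "(bessel_entire n has_field_derivative - bessel_entire (Suc n) t) (at t)"
proof -
  let ?c = "\<lambda>n m. (-1) ^ m / (fact m * fact (m + n)) :: real"
  have "diffs (?c n) m = - ?c (Suc n) m" for m
  proof -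
    have "real (Suc m) / (fact (Suc m) * fact (Suc m + n)) = 1 / (fact m * fact (m + Suc n))"
      by (simp del: of_nat_Suc)
    then have "- ((-1) ^ m) * (real (Suc m) / (fact (Suc m) * fact (Suc m + n))) = - ?c (Suc n) m"
      by simp
    then show ?thesis by (simp add: diffs_def mult_ac del: of_nat_Suc fact_Suc)
  qed
  then have "(\<Sum>m. diffs (?c n) m * t ^ m) = (\<Sum>m. - (?c (Suc n) m * t ^ m))"
    by simp
  also have "\<dots> = - bessel_entire (Suc n) t"
    unfolding bessel_entire_def by (rule suminf_minus[OF bessel_entire_summable])
  finally show ?thesis
    using termdiffs_strong_converges_everywhere[of "?c n" t, OF bessel_entire_summable]
    unfolding bessel_entire_def by simp
qed

text \<open>Compare coefficients of \<open>t ^ m\<close>. Multiplication by \<open>t\<close> shifts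
  the second series by one index, hence the \<open>if m = 0\<close> in the shifted summand.\<close>

lemma bessel_entire_rec:
  "bessel_entire n t + t * bessel_entire (n + 2) t = real (n + 1) * bessel_entire (n + 1) t"
proof -
  let ?c = "\<lambda>n m. (-1) ^ m / (fact m * fact (m + n)) :: real"
  have "(\<lambda>m. t * (?c (n + 2) m * t ^ m)) sums (t * bessel_entire (n + 2) t)"
    unfolding bessel_entire_def by (intro sums_mult summable_sums bessel_entire_summable)
  then have "(\<lambda>m. if m = 0 then 0 else t * (?c (n + 2) (m - 1) * t ^ (m - 1))) sums
      (t * bessel_entire (n + 2) t)"
    using sums_Suc[of "\<lambda>m. if m = 0 then 0 else t * (?c (n + 2) (m - 1) * t ^ (m - 1))"] by simp
  moreover have "(\<lambda>m. ?c n m * t ^ m) sums bessel_entire n t"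
    unfolding bessel_entire_def by (intro summable_sums bessel_entire_summable)
  ultimately have "(\<lambda>m. ?c n m * t ^ m +
        (if m = 0 then 0 else t * (?c (n + 2) (m - 1) * t ^ (m - 1)))) sums
      (bessel_entire n t + t * bessel_entire (n + 2) t)"
    by (rule sums_add[rotated])
  moreover have "?c n m * t ^ m + (if m = 0 then 0 else t * (?c (n + 2) (m - 1) * t ^ (m - 1))) =
      real (n + 1) * (?c (n + 1) m * t ^ m)" for m
  proof (cases m)
    case 0
    have "real (n + 1) / fact (n + 1) = (1 / fact n :: real)"
      by (simp del: of_nat_Suc)
    with 0 show ?thesis by simp
  next
    case (Suc j)
    define F G a b where "F = (fact (Suc j + n) :: real)" and "G = (fact j :: real)"
      and "a = real (Suc j)" and "b = real (n + 1)"
    have pos: "F > 0" "G > 0" "a > 0" "b > 0" "a + b > 0" by (simp_all add: F_def G_def a_def b_def)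
    have "fact (Suc j + (n + 1)) = (a + b) * F" "fact (j + (n + 2)) = (a + b) * F"
      by (simp_all add: F_def a_def b_def algebra_simps)
    moreover have "fact (Suc j) = a * G" by (simp add: a_def G_def)
    \<comment> \<open>With \<open>s\<close> = (-1)^j this is 1/a - 1/(a + b) = b / (a (a + b)),
      multiplied by the common factor -s t^(j+1) / (G F).\<close>
    moreover have "- s / (a * G * F) * (t * t ^ j) + t * (s / (G * ((a + b) * F)) * t ^ j) =
        b * (- s / (a * G * ((a + b) * F)) * (t * t ^ j))" for s
      using pos by (simp add: divide_simps) (simp add: algebra_simps)
    ultimately show ?thesis
      unfolding Suc F_def[symmetric] G_def[symmetric] b_def[symmetric] by (simp add: F_def G_def)
  qed
  ultimately have "(\<lambda>m. real (n + 1) * (?c (n + 1) m * t ^ m)) sums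
      (bessel_entire n t + t * bessel_entire (n + 2) t)"
    by simp
  moreover have "(\<lambda>m. real (n + 1) * (?c (n + 1) m * t ^ m)) sums
      (real (n + 1) * bessel_entire (n + 1) t)"
    unfolding bessel_entire_def by (intro sums_mult summable_sums bessel_entire_summable)
  ultimately show ?thesis by (rule sums_unique2)
qed

lemma bessel_J_rec:
  "x * (bessel_J n x + bessel_J (n + 2) x) = 2 * real (n + 1) * bessel_J (n + 1) x"
proof -
  have "x * (bessel_J n x + bessel_J (n + 2) x) =
      x * (x / 2) ^ n * (bessel_entire n (x\<^sup>2 / 4) + (x\<^sup>2 / 4) * bessel_entire (n + 2) (x\<^sup>2 / 4))"
    by (simp add: bessel_J_eq algebra_simps power2_eq_square)
  then show ?thesis
    by (simp only: bessel_entire_rec) (simp add: bessel_J_eq)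
qed

lemma bessel_J_0_deriv: "(bessel_J 0 has_field_derivative - bessel_J 1 x) (at x)"
proof -
  have "((\<lambda>x. bessel_entire 0 (x\<^sup>2 / 4)) has_field_derivative
      - bessel_entire (Suc 0) (x\<^sup>2 / 4) * (x / 2)) (at x)"
    by (rule DERIV_chain2[OF has_field_derivative_bessel_entire])
       (auto intro!: derivative_eq_intros)
  then show ?thesis
    by (simp add: bessel_J_eq[abs_def] mult.commute)
qed

lemma bessel_J_Suc_deriv:
  "(bessel_J (Suc n) has_field_derivative (bessel_J n x - bessel_J (n + 2) x) / 2) (at x)"
proof -
  let ?t = "x\<^sup>2 / 4"
  have *: "((\<lambda>x. bessel_entire (Suc n) (x\<^sup>2 / 4)) has_field_derivative
      - bessel_entire (Suc (Suc n)) ?t * (x / 2)) (at x)"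
    by (rule DERIV_chain2[OF has_field_derivative_bessel_entire])
       (auto intro!: derivative_eq_intros)
  have "((\<lambda>x. (x / 2) ^ Suc n * bessel_entire (Suc n) (x\<^sup>2 / 4)) has_field_derivative
      real (Suc n) * (x / 2) ^ n / 2 * bessel_entire (Suc n) ?t +
      (x / 2) ^ Suc n * (- bessel_entire (Suc (Suc n)) ?t * (x / 2))) (at x)"
    using DERIV_mult[OF DERIV_power_Suc[where n = n, OF DERIV_cdivide[OF DERIV_ident, of 2]] *]
    by (simp add: mult_ac)
  also have "real (Suc n) * (x / 2) ^ n / 2 * bessel_entire (Suc n) ?t +
      (x / 2) ^ Suc n * (- bessel_entire (Suc (Suc n)) ?t * (x / 2)) =
      (x / 2) ^ n / 2 * (real (n + 1) * bessel_entire (n + 1) ?t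
         - 2 * ?t * bessel_entire (n + 2) ?t)"
    by (simp add: algebra_simps power2_eq_square)
  also have "\<dots> = (bessel_J n x - bessel_J (n + 2) x) / 2"
    unfolding bessel_entire_rec[symmetric]
    by (simp add: bessel_J_eq algebra_simps power2_eq_square)
  finally show ?thesis by (simp add: bessel_J_eq[abs_def])
qed

text \<open>The recurrence eliminates the lower neighbour. Together with
  \<open>bessel_J_deriv_down\<close>, which eliminates the upper one, it makes (J_n, J_{n+1}) a
  closed first-order linear system, as the energy estimate requires.\<close>

lemma bessel_J_deriv_up:
  assumes "x \<noteq> 0"
  shows "(bessel_J n has_field_derivative real n / x * bessel_J n x - bessel_J (Suc n) x) (at x)"
proof (cases n)
  case 0
  then show ?thesis using bessel_J_0_deriv by simp
next
  case (Suc j)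
  have "real n / x * bessel_J n x - bessel_J (Suc n) x = (bessel_J j x - bessel_J (j + 2) x) / 2"
    using bessel_J_rec[of x j] assms Suc by (simp add: field_simps)
  then show ?thesis unfolding Suc using bessel_J_Suc_deriv[of j x] by metis
qed

lemma bessel_J_deriv_down:
  assumes "x \<noteq> 0"
  shows "(bessel_J (Suc n) has_field_derivative
           bessel_J n x - real (Suc n) / x * bessel_J (Suc n) x) (at x)"
proof -
  have "bessel_J n x - real (Suc n) / x * bessel_J (Suc n) x = (bessel_J n x - bessel_J (n + 2) x) / 2"
    using bessel_J_rec[of x n] assms by (simp add: field_simps)
  then show ?thesis using bessel_J_Suc_deriv[of n x] by metis
qed

lemma bessel_J_differentiable: "bessel_J n differentiable (at x)"
  using bessel_J_0_deriv bessel_J_Suc_deriv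
  by (cases n) (auto simp: real_differentiable_def)

lemma continuous_on_bessel_J [continuous_intros]:
  assumes "continuous_on S f"
  shows "continuous_on S (\<lambda>x. bessel_J n (f x))"
proof -
  have "continuous_on UNIV (bessel_J n)"
    using bessel_J_differentiable
    by (simp add: differentiable_imp_continuous_within continuous_on_eq_continuous_within)
  then show ?thesis
    by (rule continuous_on_compose2[OF _ assms]) auto
qed

lemma bessel_J_at_0: "bessel_J n 0 = (if n = 0 then 1 else 0)"
proof -
  have "bessel_entire 0 0 = 1"
    unfolding bessel_entire_def by (subst powser_zero) simp
  then show ?thesis by (simp add: bessel_J_eq)
qed

section \<open>Decay of the Bessel functions and of a primitive\<close>

text \<open>The correction term \<open>- (2 n + 1) J\<^sub>n J\<^sub>n\<^sub>+\<^sub>1\<close> removes the terms of the derivative of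
  \<open>x (J\<^sub>n\<^sup>2 + J\<^sub>n\<^sub>+\<^sub>1\<^sup>2)\<close> that are not integrable at infinity, so that Gronwall's argument applies.\<close>

lemma bessel_energy_bounded:
  obtains B where "\<And>x. x \<ge> real (2 * n + 1) \<Longrightarrow> x * ((bessel_J n x)\<^sup>2 + (bessel_J (Suc n) x)\<^sup>2) \<le> B"
proof -
  define a where "a = real (2 * n + 1)"
  have a: "a \<ge> 1" by (simp add: a_def)
  define V where "V x = x * ((bessel_J n x)\<^sup>2 + (bessel_J (Suc n) x)\<^sup>2)
      - a * bessel_J n x * bessel_J (Suc n) x" for x
  \<comment> \<open>\<open>exp (a / x)\<close> is the integrating factor for V' \<le> (a / x^2) V;
    it stays between 1 and e for x \<ge> a.\<close>
  define W where "W x = V x * exp (a / x)" for x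
  \<comment> \<open>By 2 J_n J_{n+1} \<le> J_n^2 + J_{n+1}^2, the correction term uses up at most
    half of the energy once x \<ge> a.\<close>
  have V_ge: "V x \<ge> x / 2 * ((bessel_J n x)\<^sup>2 + (bessel_J (Suc n) x)\<^sup>2)" if "x \<ge> a" for x
  proof -
    have "2 * (bessel_J n x * bessel_J (Suc n) x) \<le> (bessel_J n x)\<^sup>2 + (bessel_J (Suc n) x)\<^sup>2"
      using sum_squares_bound[of "bessel_J n x" "bessel_J (Suc n) x"] by (simp add: mult.assoc)
    then have "a * (2 * (bessel_J n x * bessel_J (Suc n) x)) \<le>
        a * ((bessel_J n x)\<^sup>2 + (bessel_J (Suc n) x)\<^sup>2)"
      using a by (intro mult_left_mono) auto
    also have "\<dots> \<le> x * ((bessel_J n x)\<^sup>2 + (bessel_J (Suc n) x)\<^sup>2)"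
      using that by (intro mult_right_mono) auto
    finally show ?thesis by (simp add: V_def algebra_simps)
  qed
  \<comment> \<open>The derivative of x (J_n^2 + J_{n+1}^2) is (2n+1)(J_n^2 - J_{n+1}^2), while J_n
    J_{n+1} has derivative J_n^2 - J_{n+1}^2 - J_n J_{n+1} / x. The choice a = 2n+1 therefore
    cancels the squares.\<close>
  have dV: "(V has_field_derivative a * bessel_J n x * bessel_J (Suc n) x / x) (at x)" if "x > 0" for x
  proof -
    define p q where "p = real n / x * bessel_J n x - bessel_J (Suc n) x"
      and "q = bessel_J n x - real (Suc n) / x * bessel_J (Suc n) x"
    have pq: "(bessel_J n has_field_derivative p) (at x)"
      "(bessel_J (Suc n) has_field_derivative q) (at x)"
      using bessel_J_deriv_up[of x n] bessel_J_deriv_down[of x n] that by (simp_all add: p_def q_def)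
    have "(V has_field_derivative (bessel_J n x)\<^sup>2 + (bessel_J (Suc n) x)\<^sup>2 +
        x * (2 * bessel_J n x * p + 2 * bessel_J (Suc n) x * q) -
        a * (p * bessel_J (Suc n) x + bessel_J n x * q)) (at x)"
      unfolding V_def by (auto intro!: derivative_eq_intros pq simp: algebra_simps)
    also have "(bessel_J n x)\<^sup>2 + (bessel_J (Suc n) x)\<^sup>2 +
        x * (2 * bessel_J n x * p + 2 * bessel_J (Suc n) x * q) -
        a * (p * bessel_J (Suc n) x + bessel_J n x * q) = a * bessel_J n x * bessel_J (Suc n) x / x"
      using that unfolding p_def q_def a_def
      by (simp add: divide_simps) (simp add: algebra_simps power2_eq_square)
    finally show ?thesis .
  qed
  have dW: "(W has_field_derivative
      (a * bessel_J n x * bessel_J (Suc n) x / x - V x * a / x\<^sup>2) * exp (a / x)) (at x)"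
    if "x > 0" for x
  proof -
    have "((\<lambda>x. exp (a / x)) has_field_derivative exp (a / x) * (- a / x\<^sup>2)) (at x)"
      using that by (auto intro!: derivative_eq_intros simp: power2_eq_square)
    from DERIV_mult[OF dV[OF that] this] show ?thesis
      unfolding W_def by (simp add: algebra_simps)
  qed
  have W_le: "W x \<le> W a" if "x \<ge> a" for x
  proof (rule DERIV_nonpos_imp_nonincreasing[OF that])
    fix y assume y: "a \<le> y" "y \<le> x"
    then have y0: "y > 0" using a by simp
    have "2 * (bessel_J n y * bessel_J (Suc n) y) \<le> (bessel_J n y)\<^sup>2 + (bessel_J (Suc n) y)\<^sup>2"
      using sum_squares_bound[of "bessel_J n y" "bessel_J (Suc n) y"] by (simp add: mult.assoc)
    then have "y / 2 * (2 * (bessel_J n y * bessel_J (Suc n) y)) \<le> V y"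
      using V_ge[OF y(1)] y0 by (smt (verit, best) mult_left_mono half_gt_zero)
    then have "a / y\<^sup>2 * (y * (bessel_J n y * bessel_J (Suc n) y)) \<le> a / y\<^sup>2 * V y"
      using a by (intro mult_left_mono) auto
    then have "a * bessel_J n y * bessel_J (Suc n) y / y - V y * a / y\<^sup>2 \<le> 0"
      using y0 by (simp add: field_simps power2_eq_square)
    then show "\<exists>z. (W has_real_derivative z) (at y) \<and> z \<le> 0"
      using dW[OF y0] by (auto simp: mult_nonpos_nonneg)
  qed
  show thesis
  proof (rule that)
    fix x assume "x \<ge> real (2 * n + 1)"
    then have x: "x \<ge> a" by (simp add: a_def)
    have "0 \<le> V x"
      using V_ge[OF x] x a by (smt (verit) divide_nonneg_nonneg mult_nonneg_nonneg sum_power2_ge_zero)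
    then have "V x * 1 \<le> V x * exp (a / x)"
      using x a by (intro mult_left_mono) auto
    then have "V x \<le> W a" using W_le[OF x] by (simp add: W_def)
    then show "x * ((bessel_J n x)\<^sup>2 + (bessel_J (Suc n) x)\<^sup>2) \<le> 2 * W a"
      using V_ge[OF x] by simp
  qed
qed

text \<open>The energy bound controls x \<ge> 2n+1 and compactness the remaining interval. The plain
  bound follows from the weighted one where x \<ge> 1.\<close>

lemma bessel_J_decay:
  obtains C where "C > 0" "\<And>x. x \<ge> 0 \<Longrightarrow> sqrt x * \<bar>bessel_J n x\<bar> \<le> C"
    "\<And>x. x \<ge> 0 \<Longrightarrow> \<bar>bessel_J n x\<bar> \<le> C"
proof -
  define a where "a = real (2 * n + 1)"
  have a: "a \<ge> 1" by (simp add: a_def)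
  obtain B where B: "\<And>x. x \<ge> a \<Longrightarrow> x * ((bessel_J n x)\<^sup>2 + (bessel_J (Suc n) x)\<^sup>2) \<le> B"
    using bessel_energy_bounded[of n] unfolding a_def by blast
  have "compact (bessel_J n ` {0..a})"
    by (intro compact_continuous_image continuous_intros) auto
  then obtain M where M: "\<And>x. 0 \<le> x \<Longrightarrow> x \<le> a \<Longrightarrow> \<bar>bessel_J n x\<bar> \<le> M"
    by (metis compact_imp_bounded bounded_real imageI atLeastAtMost_iff)
  have M0: "M \<ge> 0" using M[of 0] a by linarith
  define C where "C = sqrt a * M + M + sqrt \<bar>B\<bar> + 1"
  have far: "sqrt x * \<bar>bessel_J n x\<bar> \<le> sqrt \<bar>B\<bar>" if "x \<ge> a" for x
  proof -
    have "x * (bessel_J n x)\<^sup>2 \<le> x * ((bessel_J n x)\<^sup>2 + (bessel_J (Suc n) x)\<^sup>2)"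
      using that a by (intro mult_left_mono) auto
    then have "x * (bessel_J n x)\<^sup>2 \<le> \<bar>B\<bar>" using B[OF that] by linarith
    then have "sqrt (x * (bessel_J n x)\<^sup>2) \<le> sqrt \<bar>B\<bar>" by simp
    then show ?thesis by (simp add: real_sqrt_mult)
  qed
  have *: "sqrt a * M \<ge> 0" "sqrt \<bar>B\<bar> \<ge> 0" using M0 a by auto
  show thesis
  proof (rule that[of C])
    show "C > 0" using * M0 unfolding C_def by linarith
  next
    fix x :: real assume x: "x \<ge> 0"
    show "sqrt x * \<bar>bessel_J n x\<bar> \<le> C"
    proof (cases "x \<le> a")
      case True
      then have "sqrt x * \<bar>bessel_J n x\<bar> \<le> sqrt a * M"
        using x M[OF x True] a by (intro mult_mono) auto
      then show ?thesis using * M0 unfolding C_def by linarith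
    next
      case False
      then show ?thesis using far[of x] * M0 unfolding C_def by linarith
    qed
    show "\<bar>bessel_J n x\<bar> \<le> C"
    proof (cases "x \<le> a")
      case True
      then show ?thesis using M[OF x True] * unfolding C_def by linarith
    next
      case False
      then have "1 * \<bar>bessel_J n x\<bar> \<le> sqrt x * \<bar>bessel_J n x\<bar>"
        using a by (intro mult_right_mono) auto
      then show ?thesis using far[of x] * M0 False unfolding C_def by linarith
    qed
  qed
qed

text \<open>The primitive is normalised to tend to \<open>0\<close> at infinity, so its value \<open>-1\<close> at \<open>0\<close> encodes
  \<open>\<integral>\<^sub>0\<^sup>\<infinity> J\<^sub>2\<^sub>j\<^sub>+\<^sub>1 = 1\<close>.\<close>

definition bessel_tail :: "nat \<Rightarrow> real \<Rightarrow> real" where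
  "bessel_tail j x = - bessel_J 0 x - 2 * (\<Sum>i=1..j. bessel_J (2 * i) x)"

text \<open>Telescoping: -J_0' = J_1 and 2 J_{2i}' = J_{2i-1} - J_{2i+1}, so only the last Bessel
  function survives.\<close>

lemma bessel_tail_deriv:
  "(bessel_tail j has_field_derivative bessel_J (2 * j + 1) x) (at x)"
proof (induction j)
  case 0
  then show ?case
    using DERIV_minus[OF bessel_J_0_deriv[of x]] by (simp add: bessel_tail_def[abs_def])
next
  case (Suc j)
  have "bessel_tail (Suc j) = (\<lambda>x. bessel_tail j x - 2 * bessel_J (Suc (2 * j + 1)) x)"
    by (auto simp: bessel_tail_def algebra_simps)
  moreover have "((\<lambda>x. bessel_tail j x - 2 * bessel_J (Suc (2 * j + 1)) x) has_field_derivative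
      bessel_J (2 * j + 1) x - 2 * ((bessel_J (2 * j + 1) x - bessel_J (2 * j + 1 + 2) x) / 2)) (at x)"
    by (rule DERIV_diff DERIV_cmult Suc bessel_J_Suc_deriv)+
  moreover have "bessel_J (2 * j + 1) x - 2 * ((bessel_J (2 * j + 1) x - bessel_J (2 * j + 1 + 2) x) / 2) =
      bessel_J (2 * Suc j + 1) x"
    by (simp add: field_simps)
  ultimately show ?case by metis
qed

lemma bessel_tail_at_0: "bessel_tail j 0 = -1"
  by (simp add: bessel_tail_def bessel_J_at_0)

lemma bessel_tail_decay:
  obtains C where "\<And>x. x \<ge> 0 \<Longrightarrow> sqrt x * \<bar>bessel_tail j x\<bar> \<le> C"
proof -
  have "\<exists>C. \<forall>x\<ge>0. sqrt x * \<bar>bessel_J n x\<bar> \<le> C" for n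
    using bessel_J_decay[of n] by metis
  then obtain C where C: "\<And>n x. x \<ge> 0 \<Longrightarrow> sqrt x * \<bar>bessel_J n x\<bar> \<le> C n"
    by metis
  show thesis
  proof (rule that)
    fix x :: real assume x: "x \<ge> 0"
    have "\<bar>bessel_tail j x\<bar> \<le> \<bar>bessel_J 0 x\<bar> + 2 * (\<Sum>i=1..j. \<bar>bessel_J (2 * i) x\<bar>)"
      using sum_abs[of "\<lambda>i. bessel_J (2 * i) x" "{1..j}"] unfolding bessel_tail_def by linarith
    then have "sqrt x * \<bar>bessel_tail j x\<bar> \<le>
        sqrt x * (\<bar>bessel_J 0 x\<bar> + 2 * (\<Sum>i=1..j. \<bar>bessel_J (2 * i) x\<bar>))"
      using x by (intro mult_left_mono) auto
    also have "\<dots> = sqrt x * \<bar>bessel_J 0 x\<bar> + 2 * (\<Sum>i=1..j. sqrt x * \<bar>bessel_J (2 * i) x\<bar>)"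
      by (simp add: algebra_simps sum_distrib_left)
    also have "\<dots> \<le> C 0 + 2 * (\<Sum>i=1..j. C (2 * i))"
      using C[OF x] by (intro add_mono mult_left_mono sum_mono) auto
    finally show "sqrt x * \<bar>bessel_tail j x\<bar> \<le> C 0 + 2 * (\<Sum>i=1..j. C (2 * i))" .
  qed
qed

section \<open>The smoothed Bessel function\<close>

text \<open>The exponent \<open>q\<close> is left free because each differentiation in
  \<open>z\<close> produces a factor 1 / sqrt u and lowers \<open>q\<close> by 1/2. The smoothed
  density uses q = 1/2, its primitive q = 1 and its derivative q = 0.\<close>

definition smoothing :: "real \<Rightarrow> real \<Rightarrow> (real \<Rightarrow> real) \<Rightarrow> real \<Rightarrow> real" where
  "smoothing c q g z = integral {1..c} (\<lambda>u. u powr q * g (z / sqrt u))"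

lemma smoothing_integrand_continuous:
  assumes "continuous_on UNIV g"
  shows "continuous_on {1..c} (\<lambda>u. u powr q * g (z / sqrt u))"
  by (intro continuous_intros continuous_on_compose2[OF assms]) auto

lemma smoothing_integrable:
  assumes "continuous_on UNIV g"
  shows "(\<lambda>u. u powr q * g (z / sqrt u)) integrable_on {1..c}"
  by (intro integrable_continuous_interval smoothing_integrand_continuous assms)

lemma smoothing_deriv:
  assumes g: "\<And>x. (g has_field_derivative g' x) (at x)" and g': "continuous_on UNIV g'"
  shows "(smoothing c q g has_field_derivative smoothing c (q - 1 / 2) g' z) (at z)"
proof -
  have cg: "continuous_on UNIV g"
    using g by (intro DERIV_continuous_on) auto
  have *: "((\<lambda>z. t powr q * g (z / sqrt t)) has_field_derivative
      t powr (q - 1 / 2) * g' (x / sqrt t)) (at x within UNIV)" if "t \<in> cbox 1 c" for x t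
  proof -
    have t: "t > 0" using that by simp
    have "((\<lambda>z. g (z / sqrt t)) has_field_derivative g' (x / sqrt t) * (1 / sqrt t)) (at x)"
      by (rule DERIV_chain2[OF g DERIV_cdivide[OF DERIV_ident]])
    from DERIV_cmult[OF this, of "t powr q"]
    have "((\<lambda>z. t powr q * g (z / sqrt t)) has_field_derivative
        t powr q * (1 / sqrt t) * g' (x / sqrt t)) (at x)"
      by (simp add: mult_ac)
    moreover have "t powr q * (1 / sqrt t) = t powr (q - 1 / 2)"
      using t by (simp add: powr_diff powr_half_sqrt)
    ultimately show ?thesis by metis
  qed
  have "((\<lambda>z. integral (cbox 1 c) (\<lambda>u. u powr q * g (z / sqrt u))) has_field_derivative
      integral (cbox 1 c) (\<lambda>u. u powr (q - 1 / 2) * g' (z / sqrt u))) (at z within UNIV)"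
  proof (rule leibniz_rule_field_derivative[OF *])
    show "continuous_on (UNIV \<times> cbox 1 c) (\<lambda>(x, t). t powr (q - 1 / 2) * g' (x / sqrt t))"
      unfolding split_beta
      by (intro continuous_intros continuous_on_compose2[OF g']) auto
  qed (use smoothing_integrable[OF cg] in auto)
  then show ?thesis by (simp add: smoothing_def[abs_def])
qed

lemma smoothing_bound:
  assumes g: "continuous_on UNIV g" and c: "c \<ge> 1"
    and M: "\<And>u. u \<in> {1..c} \<Longrightarrow> \<bar>g (z / sqrt u)\<bar> \<le> M"
  shows "\<bar>smoothing c q g z\<bar> \<le> c powr \<bar>q\<bar> * M * (c - 1)"
proof -
  have "norm (u powr q * g (z / sqrt u)) \<le> c powr \<bar>q\<bar> * M" if u: "u \<in> {1..c}" for u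
  proof -
    \<comment> \<open>Passing to |q| treats both signs of the exponent at once, since u \<ge>
      1.\<close>
    have "u powr q \<le> u powr \<bar>q\<bar>" using u by (intro powr_mono) auto
    also have "\<dots> \<le> c powr \<bar>q\<bar>" using u by (intro powr_mono2) auto
    finally show ?thesis
      using M[OF u] by (auto simp: abs_mult intro!: mult_mono)
  qed
  then have "norm (integral {1..c} (\<lambda>u. u powr q * g (z / sqrt u))) \<le> c powr \<bar>q\<bar> * M * (c - 1)"
    by (intro integral_bound c smoothing_integrand_continuous g)
  then show ?thesis by (simp add: smoothing_def)
qed

text \<open>Rescaling the argument by 1 / sqrt u costs a factor u^(1/4), which is at most
  \<open>c\<close>.\<close>

lemma sqrt_decay_rescale:
  assumes "u \<in> {1..c}" "z > 0" "\<And>x. x \<ge> 0 \<Longrightarrow> sqrt x * \<bar>g x\<bar> \<le> C"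
  shows "\<bar>g (z / sqrt u)\<bar> \<le> c * C / sqrt z"
proof -
  have u: "1 \<le> u" "u \<le> c" using assms(1) by auto
  have C0: "C \<ge> 0" using assms(3)[of 0] by simp
  have *: "sqrt v \<le> v" if "v \<ge> 1" for v
    using that by (simp add: real_le_lsqrt power2_eq_square)
  have "sqrt (sqrt u) \<le> sqrt u" using u by (intro *) simp
  also have "\<dots> \<le> u" using u by (intro *)
  also have "\<dots> \<le> c" by (rule u)
  finally have *: "sqrt (sqrt u) \<le> c" .
  have "sqrt z * \<bar>g (z / sqrt u)\<bar> = sqrt (sqrt u) * (sqrt (z / sqrt u) * \<bar>g (z / sqrt u)\<bar>)"
    using u by (simp add: real_sqrt_divide)
  also have "\<dots> \<le> c * C"
    using assms(2) u by (intro mult_mono * assms(3)) auto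
  finally show ?thesis using assms(2) by (simp add: field_simps)
qed

lemma smoothing_sqrt_decay:
  assumes g: "continuous_on UNIV g" and c: "c \<ge> 1"
    and C: "\<And>x. x \<ge> 0 \<Longrightarrow> sqrt x * \<bar>g x\<bar> \<le> C"
  obtains K where "\<And>z. z \<ge> 0 \<Longrightarrow> sqrt z * \<bar>smoothing c q g z\<bar> \<le> K"
proof (rule that)
  have C0: "C \<ge> 0" using C[of 0] by simp
  fix z :: real assume z: "z \<ge> 0"
  show "sqrt z * \<bar>smoothing c q g z\<bar> \<le> c powr \<bar>q\<bar> * (c * C) * (c - 1)"
  proof (cases "z = 0")
    case True
    then show ?thesis using C0 c by simp
  next
    case False
    then have z: "z > 0" using z by simp
    have "\<bar>smoothing c q g z\<bar> \<le> c powr \<bar>q\<bar> * (c * C / sqrt z) * (c - 1)"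
      by (intro smoothing_bound g c sqrt_decay_rescale[OF _ z C]) auto
    then show ?thesis using z by (simp add: field_simps)
  qed
qed

text \<open>Averaging over \<open>u\<close> gains a factor \<open>1 / z\<close> over the pointwise decay: integrate by parts against
  \<open>u\<^sup>p J\<^sub>m\<^sub>+\<^sub>1(z / \<surd>u)\<close>, whose derivative contains \<open>- z / 2 \<cdot> u\<^sup>p\<^sup>-\<^sup>3\<^sup>/\<^sup>2 J\<^sub>m(z / \<surd>u)\<close>.\<close>

lemma smoothing_bessel_by_parts:
  assumes z: "z > 0" and c: "c \<ge> 1"
  shows "z / 2 * smoothing c q (bessel_J m) z =
      (q + 3 / 2 + real (Suc m) / 2) * smoothing c (q + 1 / 2) (bessel_J (Suc m)) z
      - (c powr (q + 3 / 2) * bessel_J (Suc m) (z / sqrt c) - bessel_J (Suc m) z)"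
proof -
  \<comment> \<open>The derivative of u^p J_{m+1}(z / sqrt u) carries J_m with the power u^(p -
    3/2); this \<open>p\<close> turns it into u^q.\<close>
  define p where "p = q + 3 / 2"
  define G where "G u = u powr p * bessel_J (Suc m) (z / sqrt u)" for u
  have dG: "(G has_real_derivative (p + real (Suc m) / 2) * (u powr (q + 1 / 2) * bessel_J (Suc m) (z / sqrt u))
      - z / 2 * (u powr q * bessel_J m (z / sqrt u))) (at u)" if u: "u > 0" for u
  proof -
    let ?v = "z / sqrt u"
    have v: "?v \<noteq> 0" using u z by simp
    have 1: "((\<lambda>u. z / sqrt u) has_real_derivative - z / (2 * u * sqrt u)) (at u)"
      using u by (auto intro!: derivative_eq_intros simp: field_simps)
    have 2: "((\<lambda>u. bessel_J (Suc m) (z / sqrt u)) has_real_derivative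
        (bessel_J m ?v - real (Suc m) / ?v * bessel_J (Suc m) ?v) * (- z / (2 * u * sqrt u))) (at u)"
      by (rule DERIV_chain2[OF bessel_J_deriv_down[OF v] 1])
    have 3: "((\<lambda>u. u powr p) has_real_derivative p * u powr (p - 1)) (at u)"
      using u by (rule has_real_derivative_powr)
    have e1: "u powr p = u powr q * u * sqrt u"
    proof -
      have "u powr p = u powr q * u powr 1 * u powr (1 / 2)"
        unfolding p_def powr_add[symmetric] by (rule arg_cong[where f = "(powr) u"]) simp
      then show ?thesis using u by (simp add: powr_half_sqrt)
    qed
    have e2: "u powr (p - 1) = u powr q * sqrt u" "u powr (q + 1 / 2) = u powr q * sqrt u"
      using u by (simp_all add: p_def powr_add powr_half_sqrt)
    have "p * u powr (p - 1) * bessel_J (Suc m) ?v +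
        (bessel_J m ?v - real (Suc m) / ?v * bessel_J (Suc m) ?v) * (- z / (2 * u * sqrt u)) * u powr p =
        (p + real (Suc m) / 2) * (u powr (q + 1 / 2) * bessel_J (Suc m) ?v)
        - z / 2 * (u powr q * bessel_J m ?v)"
    proof -
      \<comment> \<open>In terms of w = sqrt u the identity is rational.\<close>
      define w where "w = sqrt u"
      have w: "w > 0" "u = w * w" using u by (simp_all add: w_def)
      show ?thesis
        unfolding e1 e2 w_def[symmetric] using w z by (simp add: field_simps)
    qed
    then show ?thesis
      using DERIV_mult[OF 3 2] unfolding G_def by simp
  qed
  have "((\<lambda>u. (p + real (Suc m) / 2) * (u powr (q + 1 / 2) * bessel_J (Suc m) (z / sqrt u))
      - z / 2 * (u powr q * bessel_J m (z / sqrt u))) has_integral G c - G 1) {1..c}"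
  proof (rule fundamental_theorem_of_calculus[OF c])
    fix u assume "u \<in> {1..c}"
    then have "u > 0" by simp
    from has_field_derivative_at_within[OF dG[OF this], of "{1..c}"]
    show "(G has_vector_derivative (p + real (Suc m) / 2) * (u powr (q + 1 / 2) * bessel_J (Suc m) (z / sqrt u))
      - z / 2 * (u powr q * bessel_J m (z / sqrt u))) (at u within {1..c})"
      unfolding has_real_derivative_iff_has_vector_derivative .
  qed
  moreover have "((\<lambda>u. (p + real (Suc m) / 2) * (u powr (q + 1 / 2) * bessel_J (Suc m) (z / sqrt u))
      - z / 2 * (u powr q * bessel_J m (z / sqrt u))) has_integral
      (p + real (Suc m) / 2) * smoothing c (q + 1 / 2) (bessel_J (Suc m)) z
      - z / 2 * smoothing c q (bessel_J m) z) {1..c}"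
    unfolding smoothing_def
    by (intro has_integral_diff has_integral_mult_right integrable_integral smoothing_integrable
        continuous_intros)
  ultimately have "G c - G 1 = (p + real (Suc m) / 2) * smoothing c (q + 1 / 2) (bessel_J (Suc m)) z
      - z / 2 * smoothing c q (bessel_J m) z"
    by (rule has_integral_unique)
  then show ?thesis by (simp add: G_def p_def)
qed

text \<open>After integration by parts every term on the right is O(z^(-1/2)): the boundary terms by
  the decay of J_{m+1}, the remaining integral by \<open>smoothing_sqrt_decay\<close>. Division by z
  / 2 then gains the extra power of \<open>z\<close>.\<close>

lemma smoothing_bessel_decay:
  assumes c: "c \<ge> 1"
  obtains K where "\<And>z. z \<ge> 0 \<Longrightarrow> z * sqrt z * \<bar>smoothing c q (bessel_J m) z\<bar> \<le> K"
proof -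
  obtain C where C: "\<And>x. x \<ge> 0 \<Longrightarrow> sqrt x * \<bar>bessel_J (Suc m) x\<bar> \<le> C"
    using bessel_J_decay[of "Suc m"] by metis
  obtain K where K: "\<And>z. z \<ge> 0 \<Longrightarrow> sqrt z * \<bar>smoothing c (q + 1 / 2) (bessel_J (Suc m)) z\<bar> \<le> K"
    using smoothing_sqrt_decay[OF _ c C, of "q + 1 / 2"] continuous_on_bessel_J[OF continuous_on_id]
    by metis
  define a where "a = \<bar>q + 3 / 2 + real (Suc m) / 2\<bar>"
  define L where "L = 2 * (a * K + c powr (q + 3 / 2) * (c * C) + C)"
  have C0: "C \<ge> 0" and K0: "K \<ge> 0" using C[of 0] K[of 0] by simp_all
  show thesis
  proof (rule that)
    fix z :: real assume z: "z \<ge> 0"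
    show "z * sqrt z * \<bar>smoothing c q (bessel_J m) z\<bar> \<le> L"
    proof (cases "z = 0")
      case True
      have "L \<ge> 0" using C0 K0 c by (simp add: L_def a_def)
      then show ?thesis using True by simp
    next
      case False
      then have z: "z > 0" using z by simp
      have 1: "\<bar>bessel_J (Suc m) (z / sqrt c)\<bar> \<le> c * C / sqrt z"
        using sqrt_decay_rescale[of c c z, OF _ z C] c by simp
      have "z / 2 * \<bar>smoothing c q (bessel_J m) z\<bar> = \<bar>z / 2 * smoothing c q (bessel_J m) z\<bar>"
        using z by (simp add: abs_mult)
      also have "\<dots> \<le> a * \<bar>smoothing c (q + 1 / 2) (bessel_J (Suc m)) z\<bar> +
          (c powr (q + 3 / 2) * \<bar>bessel_J (Suc m) (z / sqrt c)\<bar> + \<bar>bessel_J (Suc m) z\<bar>)"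
      proof -
        have "\<bar>c powr (q + 3 / 2) * bessel_J (Suc m) (z / sqrt c) - bessel_J (Suc m) z\<bar> \<le>
            c powr (q + 3 / 2) * \<bar>bessel_J (Suc m) (z / sqrt c)\<bar> + \<bar>bessel_J (Suc m) z\<bar>"
          by (rule order.trans[OF abs_triangle_ineq4]) (simp add: abs_mult)
        then show ?thesis
          unfolding smoothing_bessel_by_parts[OF z c] a_def abs_mult[symmetric]
          using abs_triangle_ineq4 add_left_mono order.trans by blast
      qed
      finally have "sqrt z * (z / 2 * \<bar>smoothing c q (bessel_J m) z\<bar>) \<le>
          sqrt z * (a * \<bar>smoothing c (q + 1 / 2) (bessel_J (Suc m)) z\<bar> +
          (c powr (q + 3 / 2) * \<bar>bessel_J (Suc m) (z / sqrt c)\<bar> + \<bar>bessel_J (Suc m) z\<bar>))"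
        using z by (intro mult_left_mono) auto
      also have "\<dots> = a * (sqrt z * \<bar>smoothing c (q + 1 / 2) (bessel_J (Suc m)) z\<bar>) +
          c powr (q + 3 / 2) * (sqrt z * \<bar>bessel_J (Suc m) (z / sqrt c)\<bar>) +
          sqrt z * \<bar>bessel_J (Suc m) z\<bar>"
        by (simp add: algebra_simps)
      also have "\<dots> \<le> a * K + c powr (q + 3 / 2) * (c * C) + C"
      proof (intro add_mono mult_left_mono)
        show "sqrt z * \<bar>bessel_J (Suc m) (z / sqrt c)\<bar> \<le> c * C"
          using 1 z by (simp add: field_simps)
      qed (use K C z in \<open>auto simp: a_def\<close>)
      finally show ?thesis by (simp add: L_def algebra_simps)
    qed
  qed
qed

lemma integral_identity_Icc:
  assumes "c \<ge> (1::real)"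
  shows "integral {1..c} (\<lambda>u. u) = (c\<^sup>2 - 1) / 2"
  using assms by (intro integral_unique) (use ident_has_integral[of 1 c] in auto)

text \<open>Supplies exactly the assumptions of the locale \<open>profile\<close>, with a single
  constant for all bounds. The primitive comes from smoothing \<open>bessel_tail\<close>, shifted by
  its limit so as to vanish at 0.\<close>

lemma smoothed_bessel_profile:
  fixes c :: real and j :: nat
  assumes c: "c \<ge> 1"
  defines "H \<equiv> smoothing c (1 / 2) (bessel_J (2 * j + 1))"
  obtains \<Phi> H' C where
    "\<And>z. (\<Phi> has_field_derivative H z) (at z)"
    "\<And>z. (H has_field_derivative H' z) (at z)"
    "\<Phi> 0 = 0"
    "\<And>z. z \<ge> 0 \<Longrightarrow> sqrt z * \<bar>\<Phi> z - (c\<^sup>2 - 1) / 2\<bar> \<le> C"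
    "\<And>z. z \<ge> 0 \<Longrightarrow> \<bar>H z\<bar> \<le> C"
    "\<And>z. z \<ge> 0 \<Longrightarrow> z * sqrt z * \<bar>H z\<bar> \<le> C"
    "\<And>z. z \<ge> 0 \<Longrightarrow> z * sqrt z * \<bar>H' z\<bar> \<le> C"
proof -
  note contJ = continuous_on_bessel_J[OF continuous_on_id]
  define \<Phi> where "\<Phi> z = smoothing c 1 (bessel_tail j) z + (c\<^sup>2 - 1) / 2" for z
  define H' where "H' = smoothing c 0 (\<lambda>x. (bessel_J (2 * j) x - bessel_J (2 * j + 2) x) / 2)"
  have contT: "continuous_on UNIV (bessel_tail j)"
    unfolding bessel_tail_def by (intro continuous_intros)
  have \<Phi>': "(\<Phi> has_field_derivative H z) (at z)" for z
  proof -
    have "(smoothing c 1 (bessel_tail j) has_field_derivative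
        smoothing c (1 - 1 / 2) (bessel_J (2 * j + 1)) z) (at z)"
      by (rule smoothing_deriv[OF bessel_tail_deriv contJ])
    then show ?thesis
      unfolding \<Phi>_def H_def by (auto intro!: derivative_eq_intros)
  qed
  have H': "(H has_field_derivative H' z) (at z)" for z
  proof -
    have "(smoothing c (1 / 2) (bessel_J (Suc (2 * j))) has_field_derivative
        smoothing c (1 / 2 - 1 / 2) (\<lambda>x. (bessel_J (2 * j) x - bessel_J (2 * j + 2) x) / 2) z) (at z)"
      by (rule smoothing_deriv[OF bessel_J_Suc_deriv]) (intro continuous_intros; simp)
    then show ?thesis unfolding H_def H'_def by simp
  qed
  \<comment> \<open>Splitting the average lets \<open>smoothing_bessel_decay\<close>, which concerns
    a single Bessel function, apply to each half.\<close>
  have H'_eq: "H' z = (smoothing c 0 (bessel_J (2 * j)) z - smoothing c 0 (bessel_J (2 * j + 2)) z) / 2" for z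
  proof -
    have "((\<lambda>u. (u powr 0 * bessel_J (2 * j) (z / sqrt u) - u powr 0 * bessel_J (2 * j + 2) (z / sqrt u)) / 2)
        has_integral (smoothing c 0 (bessel_J (2 * j)) z - smoothing c 0 (bessel_J (2 * j + 2)) z) / 2) {1..c}"
      unfolding smoothing_def
      by (intro has_integral_divide has_integral_diff integrable_integral smoothing_integrable contJ)
    from integral_unique[OF this] show ?thesis
      unfolding H'_def smoothing_def by (simp only: right_diff_distrib times_divide_eq_right)
  qed
  obtain T where T: "\<And>x. x \<ge> 0 \<Longrightarrow> sqrt x * \<bar>bessel_tail j x\<bar> \<le> T"
    using bessel_tail_decay by blast
  obtain C1 where C1: "\<And>z. z \<ge> 0 \<Longrightarrow> sqrt z * \<bar>smoothing c 1 (bessel_tail j) z\<bar> \<le> C1"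
    using smoothing_sqrt_decay[OF contT c T, of 1] by blast
  obtain C2 where C2: "\<And>z. z \<ge> 0 \<Longrightarrow> z * sqrt z * \<bar>H z\<bar> \<le> C2"
    using smoothing_bessel_decay[OF c] unfolding H_def by blast
  obtain C3 where C3: "\<And>z. z \<ge> 0 \<Longrightarrow> z * sqrt z * \<bar>smoothing c 0 (bessel_J (2 * j)) z\<bar> \<le> C3"
    using smoothing_bessel_decay[OF c] by blast
  obtain C4 where C4: "\<And>z. z \<ge> 0 \<Longrightarrow> z * sqrt z * \<bar>smoothing c 0 (bessel_J (2 * j + 2)) z\<bar> \<le> C4"
    using smoothing_bessel_decay[OF c] by blast
  obtain B where B: "\<And>x. x \<ge> 0 \<Longrightarrow> \<bar>bessel_J (2 * j + 1) x\<bar> \<le> B"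
    using bessel_J_decay[of "2 * j + 1"] by metis
  obtain C5 where C5: "\<And>z. z \<ge> 0 \<Longrightarrow> \<bar>H z\<bar> \<le> C5"
  proof (rule that)
    show "\<bar>H z\<bar> \<le> c powr \<bar>1 / 2\<bar> * B * (c - 1)" if "z \<ge> 0" for z
      unfolding H_def by (intro smoothing_bound contJ c B) (use that in auto)
  qed
  have C6: "z * sqrt z * \<bar>H' z\<bar> \<le> C3 + C4" if z: "z \<ge> 0" for z
  proof -
    have "z * sqrt z * \<bar>H' z\<bar> \<le> z * sqrt z * (\<bar>smoothing c 0 (bessel_J (2 * j)) z\<bar> +
        \<bar>smoothing c 0 (bessel_J (2 * j + 2)) z\<bar>)"
      using z unfolding H'_eq by (intro mult_left_mono) auto
    then show ?thesis using C3[OF z] C4[OF z] by (simp add: distrib_left)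
  qed
  \<comment> \<open>At z = 0 the tail is constantly -1, so its average is -(c^2 - 1)/2 and cancels
    the constant added in \<Phi>.\<close>
  have "integral {1..c} (\<lambda>u. - u) = integral {1..c} (\<lambda>u. u powr 1 * bessel_tail j (0 / sqrt u))"
    by (intro integral_cong) (simp add: bessel_tail_at_0)
  then have \<Phi>0: "\<Phi> 0 = 0"
    using integral_identity_Icc[OF c] by (simp add: \<Phi>_def smoothing_def)
  show thesis
  proof (rule that[of \<Phi> H' "max (max C1 C2) (max C5 (C3 + C4))", OF \<Phi>' H' \<Phi>0])
    fix z :: real assume z: "z \<ge> 0"
    show "sqrt z * \<bar>\<Phi> z - (c\<^sup>2 - 1) / 2\<bar> \<le> max (max C1 C2) (max C5 (C3 + C4))"
      using C1[OF z] by (simp add: \<Phi>_def le_max_iff_disj)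
    show "\<bar>H z\<bar> \<le> max (max C1 C2) (max C5 (C3 + C4))"
      "z * sqrt z * \<bar>H z\<bar> \<le> max (max C1 C2) (max C5 (C3 + C4))"
      "z * sqrt z * \<bar>H' z\<bar> \<le> max (max C1 C2) (max C5 (C3 + C4))"
      using C2[OF z] C5[OF z] C6[OF z] by (simp_all add: le_max_iff_disj)
  qed
qed

section \<open>Sums over all positive integers\<close>

lemma summable_Suc_powr: "s < -1 \<Longrightarrow> summable (\<lambda>n. real (Suc n) powr s)"
  using summable_real_powr_iff[of s] by (subst summable_Suc_iff) simp

lemma summable_Suc_inverse_square: "summable (\<lambda>n. 1 / (real (Suc n))\<^sup>2)"
  using summable_Suc_powr[of "-2"] by (simp add: powr_minus powr_numeral divide_inverse)

section \<open>Sums over \<open>b\<close> compared with the telescoping primitive\<close>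

text \<open>Isolates the analytic input: the arithmetic summations below use only these properties
  of the smoothed Bessel function. \<open>I\<close> is the total integral of \<open>H\<close> over
  the half-line, expressed through the limit of its primitive.\<close>

locale profile =
  fixes \<Phi> H H' :: "real \<Rightarrow> real" and I C :: real
  assumes \<Phi>_deriv: "\<And>z. (\<Phi> has_field_derivative H z) (at z)"
    and H_deriv: "\<And>z. (H has_field_derivative H' z) (at z)"
    and \<Phi>_0: "\<Phi> 0 = 0"
    and \<Phi>_limit: "\<And>z. z \<ge> 0 \<Longrightarrow> sqrt z * \<bar>\<Phi> z - I\<bar> \<le> C"
    and H_bound: "\<And>z. z \<ge> 0 \<Longrightarrow> \<bar>H z\<bar> \<le> C"
    and H_decay: "\<And>z. z \<ge> 0 \<Longrightarrow> z * sqrt z * \<bar>H z\<bar> \<le> C"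
    and H'_decay: "\<And>z. z \<ge> 0 \<Longrightarrow> z * sqrt z * \<bar>H' z\<bar> \<le> C"
begin

lemma C_nonneg: "C \<ge> 0"
  using H_bound[of 0] by simp

text \<open>The condition x \<ge> Y / (2n) covers the whole interval from Y / (n+1) to Y / n, on
  which mean value points lie; 3 bounds 2^(3/2).\<close>

lemma decay_rescale:
  assumes f: "x * sqrt x * \<bar>f x\<bar> \<le> C" and Y: "Y > 0" and n: "n \<ge> (1::real)" and x: "x \<ge> Y / (2 * n)"
  shows "\<bar>f x\<bar> \<le> 3 * C * (n / Y) powr (3 / 2)"
proof -
  define v where "v = Y / n"
  have v: "v > 0" "x \<ge> v / 2" using Y n x by (simp_all add: v_def)
  have "v * sqrt v = 2 * sqrt 2 * ((v / 2) * sqrt (v / 2))"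
    by (simp add: real_sqrt_divide)
  also have "\<dots> \<le> 3 * ((v / 2) * sqrt (v / 2))"
  proof (intro mult_right_mono)
    have "sqrt 2 \<le> 3 / 2" by (rule real_le_lsqrt) (auto simp: power2_eq_square)
    then show "2 * sqrt 2 \<le> 3" by simp
  qed (use v in auto)
  also have "\<dots> \<le> 3 * (x * sqrt x)"
    using v by (intro mult_left_mono mult_mono) auto
  finally have "v * sqrt v * \<bar>f x\<bar> \<le> 3 * (x * sqrt x) * \<bar>f x\<bar>"
    by (rule mult_right_mono) simp
  then have *: "v * sqrt v * \<bar>f x\<bar> \<le> 3 * C" using f by simp
  have "(n / Y) powr (3 / 2) * (v * sqrt v) = 1"
  proof -
    have "v * sqrt v = v powr 1 * v powr (1 / 2)" using v by (simp add: powr_half_sqrt)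
    also have "\<dots> = v powr (3 / 2)" unfolding powr_add[symmetric] by simp
    finally show ?thesis using Y n by (simp add: v_def flip: powr_mult)
  qed
  then have "\<bar>f x\<bar> = (n / Y) powr (3 / 2) * (v * sqrt v * \<bar>f x\<bar>)"
    by (simp add: mult.assoc[symmetric])
  also have "\<dots> \<le> (n / Y) powr (3 / 2) * (3 * C)"
    using * by (intro mult_left_mono) auto
  finally show ?thesis by (simp add: mult_ac)
qed

text \<open>With w = n^2 / Y one has n^(-1/2) Y^(-3/2) = w^(1/3) (n Y)^(-7/6), so w^(1/3) times the
  minimum must be bounded. For w \<le> 1 the entry 2 suffices. For w > 1 use w^(1/3) Y / n^2 =
  w^(-2/3) \<le> 1 and w^(1/3) \<le> w^(1/2) \<le> n, the latter by Y \<ge> 1. The exponent 1/3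
  makes the powers of \<open>n\<close> and \<open>Y\<close> equal.\<close>

lemma interpolation_weight:
  assumes Y: "Y \<ge> (1::real)" and n: "n \<ge> (1::real)"
  shows "(n / Y) powr (3 / 2) / n\<^sup>2 * min 2 (Y / n\<^sup>2 + 1 / n) \<le> 2 * (n powr (- 7 / 6) * Y powr (- 7 / 6))"
proof -
  define w where "w = n\<^sup>2 / Y"
  have w: "w > 0" "w \<le> n\<^sup>2" using Y n by (simp_all add: w_def field_simps)
  have n2: "n\<^sup>2 = n powr 2" using n by (simp add: powr_numeral)
  have 1: "(n / Y) powr (3 / 2) / n\<^sup>2 = w powr (1 / 3) * (n powr (- 7 / 6) * Y powr (- 7 / 6))"
  proof -
    have "(n / Y) powr (3 / 2) / n\<^sup>2 = n powr (3 / 2 - 2) * Y powr (- (3 / 2))"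
      unfolding n2 powr_diff using n Y by (simp add: powr_divide powr_minus_divide)
    moreover have "w powr (1 / 3) = n powr (2 / 3) * Y powr (- (1 / 3))"
    proof -
      have "(n powr 2) powr (1 / 3) = n powr (2 / 3)" unfolding powr_powr by simp
      moreover have "w powr (1 / 3) = (n powr 2) powr (1 / 3) / Y powr (1 / 3)"
        unfolding w_def n2 by (simp only: powr_divide)
      ultimately show ?thesis by (simp add: powr_minus_divide)
    qed
    moreover have "n powr (3 / 2 - 2) = n powr (2 / 3) * n powr (- 7 / 6)"
      "Y powr (- (3 / 2)) = Y powr (- (1 / 3)) * Y powr (- 7 / 6)"
      by (simp_all flip: powr_add)
    ultimately show ?thesis by simp
  qed
  have 2: "w powr (1 / 3) * min 2 (Y / n\<^sup>2 + 1 / n) \<le> 2"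
  proof (cases "w \<le> 1")
    case True
    have "w powr (1 / 3) \<le> 1" using True w by (intro powr_le1) auto
    then have "w powr (1 / 3) * min 2 (Y / n\<^sup>2 + 1 / n) \<le> 1 * 2"
      using Y n by (intro mult_mono) auto
    then show ?thesis by simp
  next
    case False
    have "w powr (1 / 3) \<le> w powr 1" using False by (intro powr_mono) auto
    then have a: "w powr (1 / 3) * (Y / n\<^sup>2) \<le> 1"
      using w Y n by (simp add: w_def field_simps)
    have "w powr (1 / 3) \<le> w powr (1 / 2)" using False by (intro powr_mono) auto
    also have "\<dots> \<le> (n\<^sup>2) powr (1 / 2)" using w by (intro powr_mono2) auto
    also have "\<dots> = n" using n by (simp add: powr_half_sqrt)
    finally have b: "w powr (1 / 3) * (1 / n) \<le> 1" using n by (simp add: field_simps)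
    have "w powr (1 / 3) * min 2 (Y / n\<^sup>2 + 1 / n) \<le> w powr (1 / 3) * (Y / n\<^sup>2 + 1 / n)"
      by (intro mult_left_mono) auto
    then show ?thesis using a b by (simp add: distrib_left)
  qed
  have "(n / Y) powr (3 / 2) / n\<^sup>2 * min 2 (Y / n\<^sup>2 + 1 / n) =
      (w powr (1 / 3) * min 2 (Y / n\<^sup>2 + 1 / n)) * (n powr (- 7 / 6) * Y powr (- 7 / 6))"
    unfolding 1 by simp
  also have "\<dots> \<le> 2 * (n powr (- 7 / 6) * Y powr (- 7 / 6))"
    using 2 by (intro mult_right_mono) auto
  finally show ?thesis .
qed

text \<open>The terms with \<open>n\<^sup>2 \<le> Y\<close> are estimated trivially, the others by the mean value theorem.\<close>

lemma telescoping_error: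
  assumes Y: "Y \<ge> 1" and n: "n \<ge> (1::real)"
  shows "\<bar>H (Y / n) / n\<^sup>2 - (\<Phi> (Y / n) - \<Phi> (Y / (n + 1))) / Y\<bar> \<le>
      6 * C * (n powr (- 7 / 6) * Y powr (- 7 / 6))"
proof -
  define B where "B = 3 * C * (n / Y) powr (3 / 2)"
  have B0: "B \<ge> 0" using C_nonneg by (simp add: B_def)
  have lt: "Y / (n + 1) < Y / n" using Y n by (simp add: field_simps)
  have ge: "Y / (2 * n) \<le> Y / (n + 1)" using Y n by (simp add: field_simps)
  have pos: "Y / (2 * n) > 0" using Y n by simp
  have HB: "\<bar>H x\<bar> \<le> B" if "x \<ge> Y / (2 * n)" for x
    unfolding B_def
  proof (intro decay_rescale[where f = H and x = x] H_decay that n)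
    show "0 \<le> x" using that pos by linarith
  qed (use Y in simp)
  have H'B: "\<bar>H' x\<bar> \<le> B" if "x \<ge> Y / (2 * n)" for x
    unfolding B_def
  proof (intro decay_rescale[where f = H' and x = x] H'_decay that n)
    show "0 \<le> x" using that pos by linarith
  qed (use Y in simp)
  \<comment> \<open>The increment of \<Phi> is H(\<xi>) times the gap Y / (n (n+1)); a second mean
    value step then compares H(Y / n) with H(\<xi>).\<close>
  obtain \<xi> where \<xi>: "\<xi> > Y / (n + 1)" "\<xi> < Y / n"
    and \<Phi>_diff: "\<Phi> (Y / n) - \<Phi> (Y / (n + 1)) = (Y / n - Y / (n + 1)) * H \<xi>"
    using MVT2[OF lt] \<Phi>_deriv by metis
  obtain \<eta> where \<eta>: "\<eta> > \<xi>" "\<eta> < Y / n" and H_diff: "H (Y / n) - H \<xi> = (Y / n - \<xi>) * H' \<eta>"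
    using MVT2[OF \<xi>(2)] H_deriv by metis
  have gap: "Y / n - Y / (n + 1) = Y / (n * (n + 1))"
    using n by (simp add: field_simps)
  have main: "(\<Phi> (Y / n) - \<Phi> (Y / (n + 1))) / Y = H \<xi> / (n * (n + 1))"
    unfolding \<Phi>_diff gap using Y by simp
  have nn: "n\<^sup>2 \<le> n * (n + 1)" using n by (simp add: power2_eq_square algebra_simps)
  have n0: "n\<^sup>2 > 0" using n by simp
  have \<xi>B: "\<bar>H \<xi>\<bar> / (n * (n + 1)) \<le> B / n\<^sup>2"
    using HB[of \<xi>] \<xi> ge nn n0 B0 by (intro frac_le) auto
  have YB: "\<bar>H (Y / n)\<bar> \<le> B" using HB[of "Y / n"] lt ge by simp
  \<comment> \<open>First bound: each of the two terms separately is at most B / n^2.\<close>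
  have "\<bar>H (Y / n) / n\<^sup>2 - H \<xi> / (n * (n + 1))\<bar> \<le> \<bar>H (Y / n)\<bar> / n\<^sup>2 + \<bar>H \<xi>\<bar> / (n * (n + 1))"
    using n by (intro order.trans[OF abs_triangle_ineq4]) (simp add: abs_mult)
  also have "\<dots> \<le> B / n\<^sup>2 + B / n\<^sup>2"
    using YB by (intro add_mono \<xi>B divide_right_mono) auto
  finally have 1: "\<bar>H (Y / n) / n\<^sup>2 - H \<xi> / (n * (n + 1))\<bar> \<le> B / n\<^sup>2 * 2" by (simp only: mult_2_right)
  \<comment> \<open>Second bound: change the value of \<open>H\<close> first and the weight
    afterwards, using 1/n^2 - 1/(n(n+1)) = 1/(n^2 (n+1)).\<close>
  have split: "H (Y / n) / n\<^sup>2 - H \<xi> / (n * (n + 1)) =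
      (H (Y / n) - H \<xi>) / (n * (n + 1)) + H (Y / n) / (n\<^sup>2 * (n + 1))"
    using n by (simp add: divide_simps power2_eq_square) (simp add: algebra_simps)
  have "\<bar>H (Y / n) - H \<xi>\<bar> = (Y / n - \<xi>) * \<bar>H' \<eta>\<bar>"
    using \<xi> unfolding H_diff by (simp add: abs_mult)
  also have "\<dots> \<le> Y / n\<^sup>2 * B"
  proof (intro mult_mono)
    have "Y / n - \<xi> \<le> Y / (n * (n + 1))" using \<xi> gap by linarith
    also have "\<dots> \<le> Y / n\<^sup>2" using nn Y n by (intro divide_left_mono mult_pos_pos) auto
    finally show "Y / n - \<xi> \<le> Y / n\<^sup>2" .
  qed (use H'B[of \<eta>] \<eta> \<xi> ge Y in auto)
  finally have "\<bar>H (Y / n) - H \<xi>\<bar> / (n * (n + 1)) \<le> (Y / n\<^sup>2 * B) / n\<^sup>2"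
    using nn n0 B0 Y by (intro frac_le) auto
  moreover have "\<bar>H (Y / n)\<bar> / (n\<^sup>2 * (n + 1)) \<le> B / (n\<^sup>2 * n)"
    using YB n n0 B0 by (intro frac_le mult_left_mono) auto
  moreover have "\<bar>(H (Y / n) - H \<xi>) / (n * (n + 1)) + H (Y / n) / (n\<^sup>2 * (n + 1))\<bar> \<le>
      \<bar>H (Y / n) - H \<xi>\<bar> / (n * (n + 1)) + \<bar>H (Y / n)\<bar> / (n\<^sup>2 * (n + 1))"
    using n by (intro order.trans[OF abs_triangle_ineq]) (simp add: abs_mult)
  ultimately have "\<bar>H (Y / n) / n\<^sup>2 - H \<xi> / (n * (n + 1))\<bar> \<le> (Y / n\<^sup>2 * B) / n\<^sup>2 + B / (n\<^sup>2 * n)"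
    unfolding split by linarith
  also have "\<dots> = B / n\<^sup>2 * (Y / n\<^sup>2 + 1 / n)" by (simp add: algebra_simps)
  finally have "\<bar>H (Y / n) / n\<^sup>2 - H \<xi> / (n * (n + 1))\<bar> \<le> B / n\<^sup>2 * min 2 (Y / n\<^sup>2 + 1 / n)"
    using 1 by (simp add: min_def)
  also have "\<dots> = 3 * C * ((n / Y) powr (3 / 2) / n\<^sup>2 * min 2 (Y / n\<^sup>2 + 1 / n))"
    by (simp add: B_def)
  also have "\<dots> \<le> 3 * C * (2 * (n powr (- 7 / 6) * Y powr (- 7 / 6)))"
    using C_nonneg by (intro mult_left_mono interpolation_weight Y n) auto
  finally show ?thesis by (simp add: main)
qed

lemma summable_profile: "Y \<ge> 0 \<Longrightarrow> summable (\<lambda>b. \<bar>H (Y / real (Suc b)) / (real (Suc b))\<^sup>2\<bar>)"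
proof (rule summable_comparison_test'[OF summable_mult[OF summable_Suc_inverse_square, of C], where N = 0])
  fix b assume "Y \<ge> 0"
  then show "norm \<bar>H (Y / real (Suc b)) / (real (Suc b))\<^sup>2\<bar> \<le> C * (1 / (real (Suc b))\<^sup>2)"
    using H_bound[of "Y / real (Suc b)"] by (simp add: divide_right_mono)
qed

text \<open>For Y \<ge> 1 the telescoping errors sum because n^(-7/6) does, and the telescoped part
  \<Phi>(Y) / Y equals I / Y + O(Y^(-3/2)). For Y < 1 crude bounds suffice, as Y^(-7/6) exceeds both
  1 and 1 / Y. Small \<open>Y\<close> matter because the estimate is applied at X / a for every
  \<open>a\<close>.\<close>

lemma profile_sum_asymp:
  obtains K where "\<And>Y. Y > 0 \<Longrightarrow>
    \<bar>(\<Sum>b. H (Y / real (Suc b)) / (real (Suc b))\<^sup>2) - I / Y\<bar> \<le> K * Y powr (- 7 / 6)"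
proof -
  define Z where "Z = (\<Sum>n. 1 / (real (Suc n))\<^sup>2)"
  define S where "S = (\<Sum>n. real (Suc n) powr (- 7 / 6))"
  have Z0: "Z \<ge> 0" unfolding Z_def by (intro suminf_nonneg summable_Suc_inverse_square) auto
  have S0: "S \<ge> 0" unfolding S_def by (intro suminf_nonneg summable_Suc_powr) auto
  show thesis
  proof (rule that)
    fix Y :: real assume Y: "Y > 0"
    let ?s = "\<Sum>b. H (Y / real (Suc b)) / (real (Suc b))\<^sup>2"
    let ?K = "C * Z + \<bar>I\<bar> + 6 * C * S + C"
    show "\<bar>?s - I / Y\<bar> \<le> ?K * Y powr (- 7 / 6)"
    proof (cases "Y \<ge> 1")
      case False
      have "\<bar>?s\<bar> \<le> (\<Sum>b. \<bar>H (Y / real (Suc b)) / (real (Suc b))\<^sup>2\<bar>)"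
        using Y by (intro summable_rabs summable_profile) simp
      also have "\<dots> \<le> (\<Sum>b. C * (1 / (real (Suc b))\<^sup>2))"
      proof (intro suminf_le summable_profile summable_mult summable_Suc_inverse_square)
        fix b
        show "\<bar>H (Y / real (Suc b)) / (real (Suc b))\<^sup>2\<bar> \<le> C * (1 / (real (Suc b))\<^sup>2)"
          using H_bound[of "Y / real (Suc b)"] Y by (simp add: divide_right_mono)
      qed (use Y in auto)
      also have "\<dots> = C * Z"
        unfolding Z_def by (intro suminf_mult summable_Suc_inverse_square)
      finally have 1: "\<bar>?s\<bar> \<le> C * Z" .
      have ge1: "1 \<le> Y powr (- 7 / 6)"
        using Y False powr_mono'[of "- 7 / 6" 0 Y] by simp
      have "1 / Y = Y powr - 1" using Y by (simp add: powr_minus_divide)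
      also have "\<dots> \<le> Y powr (- 7 / 6)"
        using Y False by (intro powr_mono') auto
      finally have "\<bar>I\<bar> * (1 / Y) \<le> \<bar>I\<bar> * Y powr (- 7 / 6)" by (intro mult_left_mono) auto
      then have "\<bar>I / Y\<bar> \<le> \<bar>I\<bar> * Y powr (- 7 / 6)" using Y by simp
      moreover have "C * Z * 1 \<le> C * Z * Y powr (- 7 / 6)"
        using ge1 C_nonneg Z0 by (intro mult_left_mono) auto
      moreover have "(6 * C * S + C) * Y powr (- 7 / 6) \<ge> 0" using C_nonneg S0 by simp
      ultimately show ?thesis using 1 by (simp only: distrib_right; linarith)
    next
      case True
      define t where "t b = H (Y / real (Suc b)) / (real (Suc b))\<^sup>2 -
          (\<Phi> (Y / real (Suc b)) - \<Phi> (Y / real (Suc (Suc b)))) / Y" for b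
      have t_bound: "norm (t b) \<le> 6 * C * Y powr (- 7 / 6) * real (Suc b) powr (- 7 / 6)" for b
        using telescoping_error[OF True, of "real (Suc b)"]
        unfolding t_def by (simp add: algebra_simps)
      have sum_bound: "summable (\<lambda>b. 6 * C * Y powr (- 7 / 6) * real (Suc b) powr (- 7 / 6))"
        by (intro summable_mult summable_Suc_powr) simp
      have t_summable: "summable (\<lambda>b. norm (t b))"
        by (rule summable_comparison_test'[OF sum_bound, where N = 0]) (use t_bound in simp)
      have "\<bar>\<Sum>b. t b\<bar> \<le> (\<Sum>b. norm (t b))"
        using summable_norm[OF t_summable] by simp
      also have "\<dots> \<le> (\<Sum>b. 6 * C * Y powr (- 7 / 6) * real (Suc b) powr (- 7 / 6))"
        by (intro suminf_le t_bound t_summable sum_bound)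
      also have "\<dots> = 6 * C * Y powr (- 7 / 6) * S"
        unfolding S_def by (intro suminf_mult summable_Suc_powr) simp
      finally have 1: "\<bar>\<Sum>b. t b\<bar> \<le> 6 * C * S * Y powr (- 7 / 6)" by (simp add: mult_ac)
      \<comment> \<open>The far end of the telescope contributes \<Phi>(0) = 0, by
        continuity.\<close>
      have "(\<lambda>b. Y / real (Suc b)) \<longlonglongrightarrow> 0"
        using tendsto_mult[OF tendsto_const[of Y] LIMSEQ_inverse_real_of_nat]
        by (simp add: divide_inverse)
      moreover have "isCont \<Phi> 0" by (rule DERIV_isCont[OF \<Phi>_deriv])
      ultimately have "(\<lambda>b. \<Phi> (Y / real (Suc b))) \<longlonglongrightarrow> \<Phi> 0"
        by (rule isCont_tendsto_compose[rotated])
      from sums_divide[OF telescope_sums'[OF this], of Y]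
      have tel: "(\<lambda>b. (\<Phi> (Y / real (Suc b)) - \<Phi> (Y / real (Suc (Suc b)))) / Y) sums (\<Phi> Y / Y)"
        by (simp add: \<Phi>_0)
      have "t sums (?s - \<Phi> Y / Y)"
        unfolding t_def using Y
        by (intro sums_diff tel summable_sums summable_rabs_cancel[OF summable_profile]) simp
      then have 2: "?s = (\<Sum>b. t b) + \<Phi> Y / Y" by (simp add: sums_iff)
      have "\<bar>\<Phi> Y - I\<bar> \<le> C / sqrt Y" using \<Phi>_limit[of Y] Y by (simp add: field_simps)
      then have "\<bar>\<Phi> Y - I\<bar> / Y \<le> C / sqrt Y / Y"
        using Y by (intro divide_right_mono) auto
      then have "\<bar>\<Phi> Y / Y - I / Y\<bar> \<le> C / sqrt Y / Y"
        using Y by (simp add: diff_divide_distrib[symmetric])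
      also have "\<dots> = C * Y powr (- (3 / 2))"
      proof -
        have "Y powr (- (3 / 2)) = Y powr (- (1 / 2)) * Y powr (- 1)" unfolding powr_add[symmetric] by simp
        moreover have "Y powr (- (1 / 2)) = 1 / sqrt Y" "Y powr (- 1) = 1 / Y"
          using Y by (simp_all add: powr_minus_divide powr_half_sqrt)
        ultimately show ?thesis by simp
      qed
      also have "\<dots> \<le> C * Y powr (- 7 / 6)"
        using True C_nonneg by (intro mult_left_mono powr_mono) auto
      finally have 3: "\<bar>\<Phi> Y / Y - I / Y\<bar> \<le> C * Y powr (- 7 / 6)" .
      have "(C * Z + \<bar>I\<bar>) * Y powr (- 7 / 6) \<ge> 0" using C_nonneg Z0 by simp
      then show ?thesis using 1 2 3 by (simp only: distrib_right; linarith)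
    qed
  qed
qed

end

section \<open>Euler products\<close>

text \<open>The multiplicative function with value \<open>u p j\<close> at p^j. The normalisation u
  p 0 = 1, assumed where needed, allows the product to run over any larger finite set of
  primes.\<close>

definition mult_ext :: "(nat \<Rightarrow> nat \<Rightarrow> real) \<Rightarrow> nat \<Rightarrow> real" where
  "mult_ext u n = (\<Prod>p\<in>prime_factors n. u p (multiplicity p n))"

text \<open>Boxes of exponent vectors. Both the divisors of an integer and the sets exhausting the
  positive integers have this form, so one summation formula serves divisor sums and Euler
  products.\<close>

definition bounded_factorization :: "nat set \<Rightarrow> (nat \<Rightarrow> nat) \<Rightarrow> nat set" where
  "bounded_factorization P K =
     {n. n > 0 \<and> prime_factors n \<subseteq> P \<and> (\<forall>p\<in>P. multiplicity p n \<le> K p)}"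

lemma mult_ext_superset:
  assumes "finite P" "\<And>p. p \<in> P \<Longrightarrow> prime p" "prime_factors n \<subseteq> P" "\<And>p. p \<in> P \<Longrightarrow> u p 0 = 1"
  shows "mult_ext u n = (\<Prod>p\<in>P. u p (multiplicity p n))"
  unfolding mult_ext_def
  by (rule prod.mono_neutral_left) (use assms in \<open>auto simp: prime_factors_multiplicity\<close>)

lemma prime_power_product_superset:
  assumes "finite P" "\<And>p. p \<in> P \<Longrightarrow> prime p" "prime_factors n \<subseteq> P" "n > (0::nat)"
  shows "(\<Prod>p\<in>P. p ^ multiplicity p n) = n"
proof -
  have "(\<Prod>p\<in>prime_factors n. p ^ multiplicity p n) = (\<Prod>p\<in>P. p ^ multiplicity p n)"
    by (rule prod.mono_neutral_left) (use assms in \<open>auto simp: prime_factors_multiplicity\<close>)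
  then show ?thesis using prime_factorization_nat[OF assms(4)] by simp
qed

text \<open>Unique factorisation identifies the box with the exponent vectors in \<open>PiE\<close>,
  where a sum of products expands into a product of sums. The restriction to \<open>P\<close> fixes
  the values outside \<open>P\<close> and makes the map a bijection.\<close>

lemma
  assumes P: "finite P" "\<And>p. p \<in> P \<Longrightarrow> prime p"
  shows finite_bounded_factorization: "finite (bounded_factorization P K)"
    and sum_mult_ext: "(\<And>p. p \<in> P \<Longrightarrow> u p 0 = 1) \<Longrightarrow>
      (\<Sum>n\<in>bounded_factorization P K. mult_ext u n) = (\<Prod>p\<in>P. \<Sum>j\<le>K p. u p j)"
proof -
  let ?G = "PiE P (\<lambda>p. {..K p})"
  let ?i = "\<lambda>n. restrict (\<lambda>p. multiplicity p n) P"
  let ?j = "\<lambda>g::nat \<Rightarrow> nat. \<Prod>p\<in>P. p ^ g p"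
  have mult: "multiplicity p (?j g) = (if p \<in> P then g p else 0)" if "prime p" for p g
    by (rule multiplicity_prod_prime_powers[OF P that])
  have inv1: "?i (?j g) = g" if "g \<in> ?G" for g
  proof
    fix p
    show "?i (?j g) p = g p"
      using that mult[of p g] P(2)[of p] by (cases "p \<in> P") (auto simp: PiE_def extensional_def)
  qed
  have inv2: "?j (?i n) = n" if "n \<in> bounded_factorization P K" for n
    using prime_power_product_superset[OF P, of n] that by (auto simp: bounded_factorization_def)
  have in1: "?j g \<in> bounded_factorization P K" if "g \<in> ?G" for g
  proof -
    have "?j g > 0" using P(2) by (intro prod_pos) (auto simp: prime_gt_0_nat)
    moreover have "prime_factors (?j g) \<subseteq> P"
    proof
      fix p assume "p \<in> prime_factors (?j g)"
      then have "prime p" "multiplicity p (?j g) > 0" by (simp_all add: prime_factors_multiplicity)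
      then show "p \<in> P" using mult[of p g] by (simp split: if_splits)
    qed
    moreover have "multiplicity p (?j g) \<le> K p" if "p \<in> P" for p
      using \<open>g \<in> ?G\<close> mult[OF P(2)[OF that], of g] that by (auto simp: PiE_def)
    ultimately show ?thesis by (simp add: bounded_factorization_def)
  qed
  have in2: "?i n \<in> ?G" if "n \<in> bounded_factorization P K" for n
    using that by (auto simp: bounded_factorization_def)
  have "bounded_factorization P K \<subseteq> ?j ` ?G"
  proof
    fix n assume "n \<in> bounded_factorization P K"
    from inv2[OF this, symmetric] in2[OF this] show "n \<in> ?j ` ?G" by (rule image_eqI)
  qed
  moreover have "finite ?G" by (intro finite_PiE P) auto
  ultimately show "finite (bounded_factorization P K)" by (meson finite_imageI finite_subset)
  assume u: "\<And>p. p \<in> P \<Longrightarrow> u p 0 = 1"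
  have "(\<Sum>n\<in>bounded_factorization P K. mult_ext u n) = (\<Sum>g\<in>?G. \<Prod>p\<in>P. u p (g p))"
  proof (rule sum.reindex_bij_witness[of _ ?j ?i])
    fix n assume n: "n \<in> bounded_factorization P K"
    then have "mult_ext u n = (\<Prod>p\<in>P. u p (multiplicity p n))"
      by (intro mult_ext_superset P u) (auto simp: bounded_factorization_def)
    then show "(\<Prod>p\<in>P. u p (?i n p)) = mult_ext u n" by simp
  qed (use inv1 inv2 in1 in2 in auto)
  also have "\<dots> = (\<Prod>p\<in>P. \<Sum>j\<le>K p. u p j)"
    by (rule prod_sum_PiE[symmetric]) (use P in auto)
  finally show "(\<Sum>n\<in>bounded_factorization P K. mult_ext u n) = (\<Prod>p\<in>P. \<Sum>j\<le>K p. u p j)" .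
qed

lemma divisors_eq_bounded_factorization:
  assumes "n > (0::nat)"
  shows "{d. d dvd n} = bounded_factorization (prime_factors n) (\<lambda>p. multiplicity p n)"
proof (intro set_eqI iffI)
  fix d assume "d \<in> {d. d dvd n}"
  then have d: "d dvd n" by simp
  have "d > 0" using assms d by (rule dvd_pos_nat)
  moreover have "prime_factors d \<subseteq> prime_factors n"
    using assms d by (intro dvd_prime_factors) auto
  moreover have "multiplicity p d \<le> multiplicity p n" for p
    using assms d by (intro dvd_imp_multiplicity_le) auto
  ultimately show "d \<in> bounded_factorization (prime_factors n) (\<lambda>p. multiplicity p n)"
    by (simp add: bounded_factorization_def)
next
  fix d assume d: "d \<in> bounded_factorization (prime_factors n) (\<lambda>p. multiplicity p n)"
  show "d \<in> {d. d dvd n}"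
  proof (intro CollectI multiplicity_le_imp_dvd)
    fix p :: nat assume p: "prime p"
    show "multiplicity p d \<le> multiplicity p n"
    proof (cases "p \<in> prime_factors d")
      case True
      then show ?thesis using d by (auto simp: bounded_factorization_def)
    next
      case False
      then show ?thesis using p by (auto simp: prime_factors_multiplicity)
    qed
  qed (use d in \<open>auto simp: bounded_factorization_def\<close>)
qed

lemma sum_divisors_mult_ext:
  assumes "n > 0" "\<And>p. prime p \<Longrightarrow> u p 0 = 1"
  shows "(\<Sum>d | d dvd n. mult_ext u d) = mult_ext (\<lambda>p k. \<Sum>j\<le>k. u p j) n"
  unfolding divisors_eq_bounded_factorization[OF assms(1)]
    mult_ext_def[of "\<lambda>p k. \<Sum>j\<le>k. u p j"]
  using assms(2) in_prime_factors_imp_prime by (intro sum_mult_ext) auto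

lemma mult_ext_powr:
  assumes "n > 0"
  shows "mult_ext (\<lambda>p j. u p j * (real p ^ j) powr t) n = mult_ext u n * real n powr t"
proof -
  have "real n = (\<Prod>p\<in>prime_factors n. real p ^ multiplicity p n)"
    by (subst prime_factorization_nat[OF assms]) simp
  then have "real n powr t = (\<Prod>p\<in>prime_factors n. (real p ^ multiplicity p n) powr t)"
    by (simp add: prod_powr_distrib)
  then show ?thesis by (simp add: mult_ext_def prod.distrib)
qed

lemma abs_mult_ext: "\<bar>mult_ext u n\<bar> = mult_ext (\<lambda>p j. \<bar>u p j\<bar>) n"
  by (simp add: mult_ext_def abs_prod)

definition primes_upto :: "nat \<Rightarrow> nat set" where
  "primes_upto N = {p. prime p \<and> p \<le> N}"

lemma finite_primes_upto [simp]: "finite (primes_upto N)"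
  by (rule finite_subset[of _ "{..N}"]) (auto simp: primes_upto_def)

lemma prime_primes_upto: "p \<in> primes_upto N \<Longrightarrow> prime p"
  by (simp add: primes_upto_def)

text \<open>Primes and exponents are cut at the same \<open>N\<close>: sums over these sets are
  finite products of finite sums, and the sets eventually contain every finite set of positive
  integers.\<close>

definition exhaustion :: "nat \<Rightarrow> nat set" where
  "exhaustion N = bounded_factorization (primes_upto N) (\<lambda>_. N)"

lemma finite_exhaustion [simp]: "finite (exhaustion N)"
  unfolding exhaustion_def by (intro finite_bounded_factorization prime_primes_upto) auto

lemma exhaustion_subset: "exhaustion N \<subseteq> {1..}"
  by (auto simp: exhaustion_def bounded_factorization_def)

lemma le_imp_in_exhaustion:
  assumes "n > 0" "n \<le> N"
  shows "n \<in> exhaustion N"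
proof -
  have "p \<le> N" if "p \<in> prime_factors n" for p
    using that assms by (meson dvd_imp_le in_prime_factors_imp_dvd order_trans)
  moreover have "multiplicity p n \<le> N" if "prime p" for p
  proof -
    have "p ^ multiplicity p n \<le> n" using assms by (intro dvd_imp_le multiplicity_dvd) auto
    moreover have "multiplicity p n < p ^ multiplicity p n"
      using that by (intro power_gt_expt prime_gt_Suc_0_nat)
    ultimately show ?thesis using assms by simp
  qed
  ultimately show ?thesis
    using assms by (auto simp: exhaustion_def bounded_factorization_def primes_upto_def
        in_prime_factors_imp_prime)
qed

lemma filterlim_exhaustion: "filterlim exhaustion (finite_subsets_at_top {1..}) sequentially"
  unfolding filterlim_finite_subsets_at_top
proof safe
  fix X :: "nat set" assume X: "finite X" "X \<subseteq> {1..}"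
  obtain M where M: "\<And>x. x \<in> X \<Longrightarrow> x \<le> M"
    using X(1) finite_nat_set_iff_bounded_le by auto
  show "\<forall>\<^sub>F N in sequentially. finite (exhaustion N) \<and> X \<subseteq> exhaustion N \<and> exhaustion N \<subseteq> {1..}"
    using eventually_ge_at_top[of M]
  proof eventually_elim
    case (elim N)
    have "x \<in> exhaustion N" if "x \<in> X" for x
      using that X M[OF that] elim by (intro le_imp_in_exhaustion) auto
    then show ?case using exhaustion_subset by auto
  qed
qed

lemma has_sum_exhaustion_limit:
  assumes "(g has_sum S) {1..}"
  shows "(\<lambda>N. sum g (exhaustion N)) \<longlonglongrightarrow> S"
  using assms filterlim_exhaustion unfolding has_sum_def by (rule filterlim_compose)

text \<open>Any finite set lies in an exhaustion set, where the sum of absolute values is a finite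
  product bounded by the product of 1 + b p \<le> exp (b p), hence by the exponential of the sum of
  \<open>b\<close>.\<close>

lemma abs_summable_mult_ext:
  assumes u0: "\<And>p. prime p \<Longrightarrow> u p 0 = 1"
    and b: "\<And>p N. prime p \<Longrightarrow> (\<Sum>j=1..N. \<bar>u p j\<bar>) \<le> b p" and b0: "\<And>p. b p \<ge> 0" and sb: "summable b"
  shows "(\<lambda>n. \<bar>mult_ext u n\<bar>) summable_on {1..}"
proof (rule nonneg_bdd_above_summable_on)
  show "bdd_above (sum (\<lambda>n. \<bar>mult_ext u n\<bar>) ` {F. F \<subseteq> {1..} \<and> finite F})"
  proof (rule bdd_aboveI2)
    fix F :: "nat set" assume F: "F \<in> {F. F \<subseteq> {1..} \<and> finite F}"
    then have "finite F" by simp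
    then obtain N where N: "\<And>x. x \<in> F \<Longrightarrow> x \<le> N"
      using finite_nat_set_iff_bounded_le by metis
    have "(\<Sum>n\<in>F. \<bar>mult_ext u n\<bar>) \<le> (\<Sum>n\<in>exhaustion N. \<bar>mult_ext u n\<bar>)"
    proof (intro sum_mono2)
      show "F \<subseteq> exhaustion N" using F N by (auto intro!: le_imp_in_exhaustion)
    qed auto
    also have "\<dots> = (\<Sum>n\<in>exhaustion N. mult_ext (\<lambda>p j. \<bar>u p j\<bar>) n)"
      by (simp add: abs_mult_ext)
    also have "\<dots> = (\<Prod>p\<in>primes_upto N. \<Sum>j\<le>N. \<bar>u p j\<bar>)"
      unfolding exhaustion_def
      by (subst sum_mult_ext) (auto simp: u0 prime_primes_upto)
    also have "\<dots> \<le> (\<Prod>p\<in>primes_upto N. exp (b p))"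
    proof (intro prod_mono conjI)
      fix p assume "p \<in> primes_upto N"
      then have p: "prime p" by (rule prime_primes_upto)
      have "(\<Sum>j\<le>N. \<bar>u p j\<bar>) = \<bar>u p 0\<bar> + (\<Sum>j=1..N. \<bar>u p j\<bar>)"
        by (simp add: atMost_atLeast0 sum.atLeast_Suc_atMost)
      also have "\<dots> \<le> 1 + b p" using b[OF p, of N] u0[OF p] by simp
      also have "\<dots> \<le> exp (b p)" by (rule exp_ge_add_one_self)
      finally show "(\<Sum>j\<le>N. \<bar>u p j\<bar>) \<le> exp (b p)" .
    qed (auto intro: sum_nonneg)
    also have "\<dots> = exp (\<Sum>p\<in>primes_upto N. b p)" by (simp add: exp_sum)
    also have "\<dots> \<le> exp (suminf b)"
      using sum_le_suminf[OF sb, of "primes_upto N"] b0 by simp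
    finally show "(\<Sum>n\<in>F. \<bar>mult_ext u n\<bar>) \<le> exp (suminf b)" .
  qed
qed auto

lemma euler_product_limit:
  assumes "(mult_ext u has_sum S) {1..}" "\<And>p. prime p \<Longrightarrow> u p 0 = 1"
  shows "(\<lambda>N. \<Prod>p\<in>primes_upto N. \<Sum>j\<le>N. u p j) \<longlonglongrightarrow> S"
proof -
  have "sum (mult_ext u) (exhaustion N) = (\<Prod>p\<in>primes_upto N. \<Sum>j\<le>N. u p j)" for N
    unfolding exhaustion_def using assms(2) by (intro sum_mult_ext prime_primes_upto) (auto simp: prime_primes_upto)
  then show ?thesis using has_sum_exhaustion_limit[OF assms(1)] by simp
qed

section \<open>The coefficients of the murmuration density\<close>

lemma has_sum_Suc_iff:
  "((\<lambda>n. g (Suc n)) has_sum S) UNIV \<longleftrightarrow> (g has_sum S) {1..}"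
  by (rule has_sum_reindex_bij_betw) (rule bij_betw_byWitness[where f' = "\<lambda>n. n - 1"], auto)

text \<open>Controls the product of truncation defects 1 - p^(-2(N+1)) from below in the evaluation
  of the main constant.\<close>

lemma weierstrass_product_le:
  fixes x :: "'a \<Rightarrow> real"
  assumes "finite A" "\<And>a. a \<in> A \<Longrightarrow> 0 \<le> x a \<and> x a \<le> 1"
  shows "1 - (\<Sum>a\<in>A. x a) \<le> (\<Prod>a\<in>A. 1 - x a)"
  using assms
proof (induction A rule: finite_induct)
  case (insert a A)
  have p: "(\<Prod>a\<in>A. 1 - x a) \<le> 1" "0 \<le> (\<Prod>a\<in>A. 1 - x a)"
    using insert.prems by (auto intro!: prod_le_1 prod_nonneg)
  have "x a * (\<Prod>a\<in>A. 1 - x a) \<le> x a * 1"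
    using p insert.prems by (intro mult_left_mono) auto
  then show ?case
    using insert by (simp add: algebra_simps)
qed simp

section \<open>The divisor-sum form of Q and the size of h\<close>

definition murm_denom :: "real \<Rightarrow> real" where
  "murm_denom p = p ^ 4 - 2 * p\<^sup>2 - p + 1"

text \<open>The value of n^2 Q(n) at n = p; it is 1 + O(p^(-2)).\<close>

definition murm_ratio :: "nat \<Rightarrow> real" where
  "murm_ratio p = real p ^ 4 / murm_denom (real p)"

text \<open>The values at \<open>p\<^sup>j\<close> of the multiplicative function \<open>h\<close> with \<open>n\<^sup>2 Q(n) = \<Sum>\<^sub>d\<^sub>|\<^sub>n h(d)\<close>.\<close>

definition murm_local :: "nat \<Rightarrow> nat \<Rightarrow> real" where
  "murm_local p j = (if j = 0 then 1 else if j = 1 then murm_ratio p - 1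
     else if j = 2 then - murm_ratio p else 0)"

abbreviation murm_h :: "nat \<Rightarrow> real" where
  "murm_h \<equiv> mult_ext murm_local"

lemma murm_denom_ge:
  assumes "p \<ge> 2"
  shows "murm_denom p > 0" "p\<^sup>2 * (p ^ 4 - murm_denom p) \<le> 6 * murm_denom p"
    "p ^ 4 \<ge> murm_denom p"
proof -
  \<comment> \<open>Substituting p = 2 + t turns each difference into a polynomial with nonnegative
    coefficients.\<close>
  have "\<exists>t. p = 2 + t \<and> t \<ge> 0" by (rule exI[of _ "p - 2"]) (use assms in simp)
  then obtain t where t: "p = 2 + t" "t \<ge> 0" by blast
  have "murm_denom p = t ^ 4 + 8 * t ^ 3 + 22 * t\<^sup>2 + 23 * t + 7"
    unfolding murm_denom_def t by algebra
  then show "murm_denom p > 0" using t(2) by (simp add: add_nonneg_pos)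
  have "6 * murm_denom p - p\<^sup>2 * (p ^ 4 - murm_denom p) = 4 * t ^ 4 + 31 * t ^ 3 + 79 * t\<^sup>2 + 66 * t + 6"
    unfolding murm_denom_def t by algebra
  moreover have "4 * t ^ 4 + 31 * t ^ 3 + 79 * t\<^sup>2 + 66 * t + 6 \<ge> 0" using t(2) by simp
  ultimately show "p\<^sup>2 * (p ^ 4 - murm_denom p) \<le> 6 * murm_denom p" by linarith
  have "p ^ 4 - murm_denom p = 2 * p\<^sup>2 + (p - 1)" by (simp add: murm_denom_def)
  moreover have "2 * p\<^sup>2 + (p - 1) \<ge> 0" using assms by (intro add_nonneg_nonneg) auto
  ultimately show "p ^ 4 \<ge> murm_denom p" by linarith
qed

lemma murm_ratio_bounds:
  assumes "prime p"
  shows "1 \<le> murm_ratio p" "murm_ratio p \<le> 1 + 6 / (real p)\<^sup>2"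
proof -
  have p: "real p \<ge> 2" using prime_ge_2_nat[OF assms] by simp
  note D = murm_denom_ge[OF p]
  show "1 \<le> murm_ratio p" using D unfolding murm_ratio_def by (simp add: field_simps)
  have "murm_ratio p - 1 = (real p ^ 4 - murm_denom p) / murm_denom p"
    using D unfolding murm_ratio_def by (simp add: diff_divide_distrib)
  also have "\<dots> \<le> 6 / (real p)\<^sup>2"
    using D p by (simp add: divide_simps mult_ac)
  finally show "murm_ratio p \<le> 1 + 6 / (real p)\<^sup>2" by simp
qed

text \<open>Inversion at prime powers: n^2 Q(n) takes the values 1, R, 0, 0, ... at 1, p, p^2, p^3,
  ... with R = \<open>murm_ratio p\<close>, and \<open>murm_local\<close> lists the successive
  differences 1, R - 1, -R, 0.\<close>

lemma murm_local_partial_sum: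
  "(\<Sum>j\<le>k. murm_local p j) = (if k = 0 then 1 else if k = 1 then murm_ratio p else 0)"
proof -
  have "(\<Sum>j\<le>Suc (Suc m). murm_local p j) = 0" for m
    by (induction m) (simp_all add: murm_local_def)
  moreover have "k = 0 \<or> k = 1 \<or> (\<exists>m. k = Suc (Suc m))" by presburger
  ultimately show ?thesis by (auto simp: murm_local_def)
qed

lemma murm_Q_eq_prod:
  assumes "n > 0"
  shows "murm_Q n * (real n)\<^sup>2 = (if squarefree n then \<Prod>p\<in>prime_factors n. murm_ratio p else 0)"
proof (cases "squarefree n")
  case True
  have "real n = real (\<Prod>p\<in>prime_factors n. p ^ multiplicity p n)"
    using prime_factorization_nat[OF assms] by simp
  also have "\<dots> = (\<Prod>p\<in>prime_factors n. real p)"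
    using True assms by (simp add: squarefree_factorial_semiring' cong: prod.cong)
  finally have n: "(real n)\<^sup>2 = (\<Prod>p\<in>prime_factors n. (real p)\<^sup>2)"
    by (simp add: prod_power_distrib)
  have "((-1 :: int) ^ card (prime_factors n))\<^sup>2 = 1"
    by (simp flip: power_mult power_even_eq)
  then have "murm_Q n = (\<Prod>p\<in>prime_factors n. (real p)\<^sup>2 / murm_denom p)"
    using True by (simp add: murm_Q_def moebius_mu_def murm_denom_def)
  then show ?thesis
    using True unfolding n
    by (simp add: murm_ratio_def flip: prod.distrib)
qed (simp add: murm_Q_def moebius_mu_def)

lemma murm_Q_eq_sum:
  assumes "n > 0"
  shows "murm_Q n = (\<Sum>d | d dvd n. murm_h d) / (real n)\<^sup>2"
proof -
  have "(\<Sum>d | d dvd n. murm_h d) = mult_ext (\<lambda>p k. \<Sum>j\<le>k. murm_local p j) n"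
    using assms by (intro sum_divisors_mult_ext) (auto simp: murm_local_def)
  also have "\<dots> = (\<Prod>p\<in>prime_factors n. if multiplicity p n = 1 then murm_ratio p else 0)"
    unfolding mult_ext_def murm_local_partial_sum
    by (intro prod.cong) (auto simp: prime_factors_multiplicity)
  also have "\<dots> = (if squarefree n then \<Prod>p\<in>prime_factors n. murm_ratio p else 0)"
  proof (cases "squarefree n")
    case True
    then show ?thesis
      using assms by (auto simp: squarefree_factorial_semiring' intro!: prod.cong)
  next
    case False
    then obtain p where "p \<in> prime_factors n" "multiplicity p n \<noteq> 1"
      using assms by (auto simp: squarefree_factorial_semiring')
    then show ?thesis using False by (auto intro!: prod_zero)
  qed
  also have "\<dots> = murm_Q n * (real n)\<^sup>2" using murm_Q_eq_prod[OF assms] by simp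
  finally show ?thesis using assms by simp
qed

text \<open>On squarefree \<open>n\<close> the product of the ratios 1 + O(p^(-2)) is at most the
  exponential of the convergent sum of 6 / p^2.\<close>

lemma murm_Q_bounds:
  obtains B where "B > 0" "\<And>n. n > 0 \<Longrightarrow> 0 \<le> murm_Q n" "\<And>n. n > 0 \<Longrightarrow> murm_Q n \<le> B / (real n)\<^sup>2"
proof -
  define b where "b p = 6 / (real p)\<^sup>2" for p :: nat
  have b: "summable b"
    using summable_mult[OF inverse_power_summable[of 2, where 'a = real], of 6]
    by (simp add: b_def[abs_def] divide_inverse)
  have b0: "b p \<ge> 0" for p by (simp add: b_def)
  have *: "0 \<le> murm_Q n * (real n)\<^sup>2 \<and> murm_Q n * (real n)\<^sup>2 \<le> exp (suminf b)" if n: "n > 0" for n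
  proof -
    have pr: "prime p" if "p \<in> prime_factors n" for p
      using that by (rule in_prime_factors_imp_prime)
    have "0 \<le> (\<Prod>p\<in>prime_factors n. murm_ratio p)"
      using murm_ratio_bounds(1)[OF pr] by (intro prod_nonneg) (meson order_trans zero_le_one)
    moreover have "(\<Prod>p\<in>prime_factors n. murm_ratio p) \<le> (\<Prod>p\<in>prime_factors n. exp (b p))"
    proof (intro prod_mono conjI)
      fix p assume p: "p \<in> prime_factors n"
      show "0 \<le> murm_ratio p" using murm_ratio_bounds(1)[OF pr[OF p]] by linarith
      have "murm_ratio p \<le> 1 + b p" using murm_ratio_bounds(2)[OF pr[OF p]] by (simp add: b_def)
      also have "\<dots> \<le> exp (b p)" by (rule exp_ge_add_one_self)
      finally show "murm_ratio p \<le> exp (b p)" .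
    qed
    moreover have "(\<Prod>p\<in>prime_factors n. exp (b p)) = exp (\<Sum>p\<in>prime_factors n. b p)"
      by (simp add: exp_sum)
    moreover have "(\<Sum>p\<in>prime_factors n. b p) \<le> suminf b"
      by (intro sum_le_suminf b) (auto simp: b0)
    ultimately show ?thesis
      unfolding murm_Q_eq_prod[OF n] by (auto intro: order_trans)
  qed
  show thesis
  proof (rule that[of "exp (suminf b)"])
    fix n :: nat assume n: "n > 0"
    then have n2: "(real n)\<^sup>2 > 0" by simp
    show "0 \<le> murm_Q n" using *[OF n] n2 by (simp add: zero_le_mult_iff)
    show "murm_Q n \<le> exp (suminf b) / (real n)\<^sup>2" using *[OF n] n2 by (simp add: field_simps)
  qed simp
qed

text \<open>The value at \<open>p\<close> is O(p^(-2)) and the value at p^2 is bounded, so the local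
  sums are O(p^(-5/3)). The constant 9 is 6 from h(p) plus 3 from h(p^2). The exponent -5/6 is -2 +
  7/6, which arises when the error (X / a)^(-7/6) is weighted by a^(-2).\<close>

lemma murm_h_powr_summable:
  assumes "t \<le> -5 / 6"
  shows "(\<lambda>n. \<bar>murm_h n\<bar> * real n powr t) summable_on {1..}"
proof -
  define u where "u p j = murm_local p j * (real p ^ j) powr t" for p j
  have "(\<lambda>n. \<bar>mult_ext u n\<bar>) summable_on {1..}"
  proof (rule abs_summable_mult_ext)
    show "u p 0 = 1" if "prime p" for p by (simp add: u_def murm_local_def)
    show "summable (\<lambda>p. 9 * real p powr (-5 / 3))"
      by (intro summable_mult) (simp add: summable_real_powr_iff)
    show "0 \<le> 9 * real p powr (-5 / 3)" for p by simp
    fix p N assume p: "prime (p :: nat)"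
    have p2: "real p \<ge> 2" using prime_ge_2_nat[OF p] by simp
    have "(\<Sum>j=1..N. \<bar>u p j\<bar>) \<le> (\<Sum>j\<in>{1,2}. \<bar>u p j\<bar>)"
    proof -
      have "(\<Sum>j=1..N. \<bar>u p j\<bar>) = (\<Sum>j\<in>{1..N} \<inter> {1,2}. \<bar>u p j\<bar>)"
        by (rule sum.mono_neutral_right) (auto simp: u_def murm_local_def)
      also have "\<dots> \<le> (\<Sum>j\<in>{1,2}. \<bar>u p j\<bar>)" by (intro sum_mono2) auto
      finally show ?thesis .
    qed
    also have "\<dots> = (murm_ratio p - 1) * real p powr t + murm_ratio p * ((real p)\<^sup>2) powr t"
      using murm_ratio_bounds(1)[OF p] by (simp add: u_def murm_local_def abs_mult)
    also have "\<dots> \<le> 6 * real p powr (-5 / 3) + 3 * real p powr (-5 / 3)"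
    proof (intro add_mono)
      have "(murm_ratio p - 1) * real p powr t \<le> (6 / (real p)\<^sup>2) * real p powr 0"
        using murm_ratio_bounds[OF p] p2 assms by (intro mult_mono powr_mono) auto
      also have "\<dots> = 6 * real p powr (-2)"
        using p2 by (simp add: powr_minus_divide powr_numeral)
      also have "\<dots> \<le> 6 * real p powr (-5 / 3)"
        using p2 by (intro mult_left_mono powr_mono) auto
      finally show "(murm_ratio p - 1) * real p powr t \<le> 6 * real p powr (-5 / 3)" .
      have "6 / (real p)\<^sup>2 \<le> 6 / 2\<^sup>2" using p2 by (intro divide_left_mono power_mono) auto
      then have "murm_ratio p \<le> 3" using murm_ratio_bounds(2)[OF p] by simp
      moreover have "((real p)\<^sup>2) powr t \<le> real p powr (-5 / 3)"
      proof -
        have "((real p)\<^sup>2) powr t = real p powr (2 * t)"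
          using p2 by (simp add: powr_powr flip: powr_numeral)
        also have "\<dots> \<le> real p powr (-5 / 3)" using p2 assms by (intro powr_mono) auto
        finally show ?thesis .
      qed
      ultimately show "murm_ratio p * ((real p)\<^sup>2) powr t \<le> 3 * real p powr (-5 / 3)"
        using murm_ratio_bounds(1)[OF p] by (intro mult_mono) auto
    qed
    finally show "(\<Sum>j=1..N. \<bar>u p j\<bar>) \<le> 9 * real p powr (-5 / 3)" by simp
  qed
  also have "(\<lambda>n. \<bar>mult_ext u n\<bar>) summable_on {1..} \<longleftrightarrow> (\<lambda>n. \<bar>murm_h n\<bar> * real n powr t) summable_on {1..}"
    unfolding u_def by (intro summable_on_cong) (simp add: mult_ext_powr abs_mult)
  finally show ?thesis .
qed

text \<open>As \<open>h\<close> vanishes beyond p^2, truncation at N \<ge> 2 already gives the exact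
  factor 1 + (R - 1)/p - R/p^2, which splits as shown.\<close>

lemma murm_h_euler_factor:
  assumes "prime p" "N \<ge> 2"
  shows "(\<Sum>j\<le>N. murm_local p j * (real p ^ j) powr -1) = (1 - 1 / real p) * (1 + murm_ratio p / real p)"
proof -
  have p: "real p > 0" using prime_gt_0_nat[OF assms(1)] by simp
  have "(\<Sum>j\<le>N. murm_local p j * (real p ^ j) powr -1) =
      (\<Sum>j\<in>{0,1,2}. murm_local p j * (real p ^ j) powr -1)"
    by (rule sum.mono_neutral_right) (use assms in \<open>auto simp: murm_local_def\<close>)
  also have "\<dots> = (1 - 1 / real p) * (1 + murm_ratio p / real p)"
    using p by (simp add: murm_local_def powr_minus_divide field_simps power2_eq_square)
  finally show ?thesis .
qed

section \<open>The constant \<alpha> and the cancellation of Euler factors\<close>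

definition murm_alpha_factor :: "nat \<Rightarrow> real" where
  "murm_alpha_factor p = (if prime p
     then (1 - real p - 2 * real p ^ 2 + real p ^ 4) / (real p ^ 4 - 2 * real p ^ 2 + real p) else 1)"

lemma murm_alpha_eq: "murm_alpha = 2 * pi * prodinf murm_alpha_factor"
  by (simp add: murm_alpha_def murm_alpha_factor_def[abs_def])

text \<open>The second inequality bounds the distance (2p - 1) / (p^4 - 2p^2 + p) of the Euler
  factor from 1 by 4 / p^2, which gives absolute convergence of the product.\<close>

lemma murm_alpha_denom_pos:
  assumes "p \<ge> (2 :: real)"
  shows "p ^ 4 - 2 * p\<^sup>2 + p > 0" "p\<^sup>2 * (2 * p - 1) \<le> 4 * (p ^ 4 - 2 * p\<^sup>2 + p)"
proof -
  have "\<exists>t. p = 2 + t \<and> t \<ge> 0" by (rule exI[of _ "p - 2"]) (use assms in simp)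
  then obtain t where t: "p = 2 + t" "t \<ge> 0" by blast
  have "p ^ 4 - 2 * p\<^sup>2 + p = t ^ 4 + 8 * t ^ 3 + 22 * t\<^sup>2 + 25 * t + 10"
    unfolding t by algebra
  then show "p ^ 4 - 2 * p\<^sup>2 + p > 0" using t(2) by (simp add: add_nonneg_pos)
  have "4 * (p ^ 4 - 2 * p\<^sup>2 + p) - p\<^sup>2 * (2 * p - 1) =
      4 * t ^ 4 + 30 * t ^ 3 + 77 * t\<^sup>2 + 80 * t + 28"
    unfolding t by algebra
  moreover have "4 * t ^ 4 + 30 * t ^ 3 + 77 * t\<^sup>2 + 80 * t + 28 \<ge> 0" using t(2) by simp
  ultimately show "p\<^sup>2 * (2 * p - 1) \<le> 4 * (p ^ 4 - 2 * p\<^sup>2 + p)" by linarith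
qed

lemma murm_alpha_factor_tendsto:
  "(\<lambda>N. \<Prod>p\<in>primes_upto N. murm_alpha_factor p) \<longlonglongrightarrow> prodinf murm_alpha_factor"
proof -
  have "convergent_prod murm_alpha_factor"
  proof (rule abs_convergent_prod_imp_convergent_prod, rule summable_imp_abs_convergent_prod,
      rule summable_comparison_test'[where N = 0])
    show "summable (\<lambda>p. 4 * inverse (real p ^ 2))"
      by (intro summable_mult inverse_power_summable) simp
    fix p :: nat
    show "norm (norm (murm_alpha_factor p - 1)) \<le> 4 * inverse (real p ^ 2)"
    proof (cases "prime p")
      case True
      have p: "real p \<ge> 2" using prime_ge_2_nat[OF True] by simp
      note D = murm_alpha_denom_pos[OF p]
      have "murm_alpha_factor p - 1 = - ((2 * real p - 1) / (real p ^ 4 - 2 * real p ^ 2 + real p))"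
        using D(1) True unfolding murm_alpha_factor_def by (simp add: field_simps)
      then have "\<bar>murm_alpha_factor p - 1\<bar> = (2 * real p - 1) / (real p ^ 4 - 2 * real p ^ 2 + real p)"
        using D(1) p by simp
      also have "\<dots> \<le> 4 * inverse (real p ^ 2)"
        using D p by (simp add: field_simps)
      finally show ?thesis by simp
    qed (simp add: murm_alpha_factor_def)
  qed
  then have "(\<lambda>N. \<Prod>i\<le>N. murm_alpha_factor i) \<longlonglongrightarrow> prodinf murm_alpha_factor"
    by (rule convergent_prod_LIMSEQ)
  moreover have "(\<Prod>i\<le>N. murm_alpha_factor i) = (\<Prod>p\<in>primes_upto N. murm_alpha_factor p)" for N
    by (rule prod.mono_neutral_right) (auto simp: primes_upto_def murm_alpha_factor_def)
  ultimately show ?thesis by simp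
qed

text \<open>Writing the \<alpha>-factor as D / E and the ratio as x^4 / D, everything reduces to the
  polynomial identity (x - 1)(D + x^3) x = E (x^2 - 1). What remains is the Euler factor of 1 /
  zeta(2).\<close>

lemma euler_factor_cancellation:
  assumes "prime p"
  shows "murm_alpha_factor p * ((1 - 1 / real p) * (1 + murm_ratio p / real p)) = 1 - 1 / (real p)\<^sup>2"
proof -
  define x where "x = real p"
  have x: "x \<ge> 2" using prime_ge_2_nat[OF assms] by (simp add: x_def)
  define D E where "D = murm_denom x" and "E = x ^ 4 - 2 * x\<^sup>2 + x"
  have D: "D > 0" and E: "E > 0"
    using murm_denom_ge(1)[OF x] murm_alpha_denom_pos(1)[OF x] by (simp_all add: D_def E_def)
  have "murm_alpha_factor p = D / E"
    using assms by (simp add: murm_alpha_factor_def D_def E_def murm_denom_def x_def algebra_simps)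
  moreover have "murm_ratio p = x ^ 4 / D" by (simp add: murm_ratio_def D_def x_def)
  moreover have "D / E * ((1 - 1 / x) * (1 + x ^ 4 / D / x)) = 1 - 1 / x\<^sup>2"
  proof -
    have "(x - 1) * (D + x ^ 3) * x = E * (x\<^sup>2 - 1)"
      unfolding D_def E_def murm_denom_def by algebra
    moreover have "D / E * ((1 - 1 / x) * (1 + x ^ 4 / D / x)) = ((x - 1) * (D + x ^ 3) * x) / (E * x\<^sup>2)"
    proof -
      have "1 + x ^ 4 / D / x = (D + x ^ 3) / D"
        using D x by (simp add: field_simps power4_eq_xxxx power3_eq_cube)
      moreover have "1 - 1 / x = ((x - 1) * x) / x\<^sup>2"
        using x by (simp add: field_simps power2_eq_square)
      ultimately show ?thesis using D by simp
    qed
    moreover have "E * (x\<^sup>2 - 1) / (E * x\<^sup>2) = 1 - 1 / x\<^sup>2"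
      using E x by (simp add: diff_divide_distrib)
    ultimately show ?thesis by simp
  qed
  ultimately show ?thesis by (simp add: x_def)
qed

definition murm_kappa :: real where
  "murm_kappa = (\<Sum>\<^sub>\<infinity>n\<in>{1..}. murm_h n / real n)"

lemma murm_h_summable:
  "(\<lambda>n. \<bar>murm_h n\<bar> / real n) summable_on {1..}" "(\<lambda>n. murm_h n / real n) summable_on {1..}"
  "(\<lambda>n. \<bar>murm_h n\<bar> / (real n)\<^sup>2) summable_on {1..}"
proof -
  have s: "(\<lambda>n. \<bar>murm_h n\<bar> * real n powr -1) summable_on {1..}"
    "(\<lambda>n. \<bar>murm_h n\<bar> * real n powr -2) summable_on {1..}"
    by (rule murm_h_powr_summable; simp)+
  have e: "real n powr -1 = 1 / real n" "real n powr -2 = 1 / (real n)\<^sup>2" for n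
    by (simp_all add: powr_minus_divide)
  show "(\<lambda>n. \<bar>murm_h n\<bar> / (real n)\<^sup>2) summable_on {1..}"
    using s(2) unfolding e times_divide_eq_right mult_1_right .
  show "(\<lambda>n. \<bar>murm_h n\<bar> / real n) summable_on {1..}"
    using s(1) unfolding e times_divide_eq_right mult_1_right .
  then have "(\<lambda>n. norm (murm_h n / real n)) summable_on {1..}" by simp
  then show "(\<lambda>n. murm_h n / real n) summable_on {1..}"
    by (rule abs_summable_summable)
qed

text \<open>The three products, taken over primes up to the same \<open>N\<close>, are multiplied
  before passing to the limit; their local factors cancel except for the truncation of the zeta
  factors.\<close>

lemma murm_alpha_kappa_zeta2:
  "murm_alpha * murm_kappa * (\<Sum>n. 1 / (real (Suc n))\<^sup>2) = 2 * pi"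
proof -
  define Z where "Z = (\<Sum>n. 1 / (real (Suc n))\<^sup>2)"
  have "((\<lambda>n. 1 / (real n)\<^sup>2) has_sum Z) {1..}"
    unfolding has_sum_Suc_iff[symmetric] Z_def
    by (intro norm_summable_imp_has_sum summable_sums) (use summable_Suc_inverse_square in auto)
  then have "(mult_ext (\<lambda>p j. 1 * (real p ^ j) powr -2) has_sum Z) {1..}"
  proof (rule has_sum_cong[THEN iffD1, rotated])
    fix n :: nat assume "n \<in> {1..}"
    then have "n > 0" by simp
    from mult_ext_powr[OF this, of "\<lambda>_ _. 1" "-2"] this
    show "1 / (real n)\<^sup>2 = mult_ext (\<lambda>p j. 1 * (real p ^ j) powr -2) n"
      by (simp add: mult_ext_def powr_minus_divide powr_numeral)
  qed
  then have Z_lim: "(\<lambda>N. \<Prod>p\<in>primes_upto N. \<Sum>j\<le>N. 1 * (real p ^ j) powr -2) \<longlonglongrightarrow> Z"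
    by (rule euler_product_limit) simp
  have "((\<lambda>n. murm_h n / real n) has_sum murm_kappa) {1..}"
    unfolding murm_kappa_def by (intro has_sum_infsum murm_h_summable)
  then have "(mult_ext (\<lambda>p j. murm_local p j * (real p ^ j) powr -1) has_sum murm_kappa) {1..}"
  proof (rule has_sum_cong[THEN iffD1, rotated])
    fix n :: nat assume "n \<in> {1..}"
    then have "n > 0" by simp
    from mult_ext_powr[OF this, of murm_local "-1"] this
    show "murm_h n / real n = mult_ext (\<lambda>p j. murm_local p j * (real p ^ j) powr -1) n"
      by (simp add: powr_minus_divide)
  qed
  then have K_lim: "(\<lambda>N. \<Prod>p\<in>primes_upto N. \<Sum>j\<le>N. murm_local p j * (real p ^ j) powr -1) \<longlonglongrightarrow> murm_kappa"
    by (rule euler_product_limit) (simp add: murm_local_def)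
  \<comment> \<open>The uncancelled remainder: (1 - x) times the sum of x^j for j \<le> N is 1 -
    x^(N+1), with x = p^(-2).\<close>
  define L where "L N = (\<Prod>p\<in>primes_upto N. 1 - (1 / (real p)\<^sup>2) ^ Suc N)" for N
  have eq: "(\<Prod>p\<in>primes_upto N. murm_alpha_factor p) *
      (\<Prod>p\<in>primes_upto N. \<Sum>j\<le>N. murm_local p j * (real p ^ j) powr -1) *
      (\<Prod>p\<in>primes_upto N. \<Sum>j\<le>N. 1 * (real p ^ j) powr -2) = L N" if N: "N \<ge> 2" for N
    unfolding L_def prod.distrib[symmetric]
  proof (rule prod.cong[OF refl])
    fix p assume "p \<in> primes_upto N"
    then have p: "prime p" by (rule prime_primes_upto)
    have p0: "real p > 0" using prime_gt_0_nat[OF p] by simp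
    have "(\<Sum>j\<le>N. 1 * (real p ^ j) powr -2) = (\<Sum>j\<le>N. (1 / (real p)\<^sup>2) ^ j)"
      using p0 by (intro sum.cong)
        (auto simp: powr_minus_divide powr_numeral power_divide power_mult[symmetric] mult.commute)
    moreover have "(1 - 1 / (real p)\<^sup>2) * (\<Sum>j\<le>N. (1 / (real p)\<^sup>2) ^ j) = 1 - (1 / (real p)\<^sup>2) ^ Suc N"
      using sum_gp_multiplied[of 0 N "1 / (real p)\<^sup>2"] by (simp add: atMost_atLeast0)
    ultimately show "murm_alpha_factor p * (\<Sum>j\<le>N. murm_local p j * (real p ^ j) powr -1) *
        (\<Sum>j\<le>N. 1 * (real p ^ j) powr -2) = 1 - (1 / (real p)\<^sup>2) ^ Suc N"
      by (simp only: murm_h_euler_factor[OF p N] euler_factor_cancellation[OF p])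
  qed
  \<comment> \<open>At most N + 1 primes occur, and each defect is at most (1/4)^(N+1) because p
    \<ge> 2.\<close>
  have "L \<longlonglongrightarrow> 1"
  proof (rule tendsto_sandwich[of "\<lambda>N. 1 - real (Suc N) * (1 / 4) ^ Suc N" _ _ "\<lambda>_. 1"])
    have small: "0 \<le> (1 / (real p)\<^sup>2) ^ Suc N \<and> (1 / (real p)\<^sup>2) ^ Suc N \<le> (1 / 4) ^ Suc N"
      if "p \<in> primes_upto N" for p N
    proof -
      have "2 \<le> real p" using prime_ge_2_nat[OF prime_primes_upto[OF that]] by simp
      then have "2\<^sup>2 \<le> (real p)\<^sup>2" "0 < (real p)\<^sup>2" using power_mono[of 2 "real p" 2] by auto
      then have "1 / (real p)\<^sup>2 \<le> 1 / 4" by (simp add: divide_simps)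
      then show ?thesis by (intro conjI power_mono) auto
    qed
    have le1: "(1 / 4 :: real) ^ Suc N \<le> 1" for N by (intro power_le_one) auto
    have factor: "0 \<le> 1 - (1 / (real p)\<^sup>2) ^ Suc N \<and> 1 - (1 / (real p)\<^sup>2) ^ Suc N \<le> 1"
      "0 \<le> (1 / (real p)\<^sup>2) ^ Suc N \<and> (1 / (real p)\<^sup>2) ^ Suc N \<le> 1"
      if "p \<in> primes_upto N" for p N
      using small[OF that] le1[of N] by linarith+
    show "\<forall>\<^sub>F N in sequentially. L N \<le> 1"
    proof (intro always_eventually allI)
      fix N show "L N \<le> 1"
        unfolding L_def by (intro prod_le_1 factor)
    qed
    show "\<forall>\<^sub>F N in sequentially. 1 - real (Suc N) * (1 / 4) ^ Suc N \<le> L N"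
    proof (intro always_eventually allI)
      fix N
      have "(\<Sum>p\<in>primes_upto N. (1 / (real p)\<^sup>2) ^ Suc N) \<le> (\<Sum>p\<in>primes_upto N. (1 / 4) ^ Suc N)"
        using small[of _ N] by (intro sum_mono) blast
      also have "\<dots> = real (card (primes_upto N)) * (1 / 4) ^ Suc N" by simp
      also have "\<dots> \<le> real (Suc N) * (1 / 4) ^ Suc N"
      proof -
        have "card (primes_upto N) \<le> card {..N}"
          by (intro card_mono) (auto simp: primes_upto_def)
        then show ?thesis by (intro mult_right_mono) auto
      qed
      finally show "1 - real (Suc N) * (1 / 4) ^ Suc N \<le> L N"
        using weierstrass_product_le[of "primes_upto N" "\<lambda>p. (1 / (real p)\<^sup>2) ^ Suc N",
            OF finite_primes_upto factor(2)]
        unfolding L_def by linarith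
    qed
    have "(\<lambda>N. real N * (1 / 4) ^ N) \<longlonglongrightarrow> 0"
      by (rule powser_times_n_limit_0) simp
    then have "(\<lambda>N. real (Suc N) * (1 / 4) ^ Suc N) \<longlonglongrightarrow> 0" by (rule LIMSEQ_Suc)
    from tendsto_diff[OF tendsto_const[of 1] this]
    show "(\<lambda>N. 1 - real (Suc N) * (1 / 4) ^ Suc N) \<longlonglongrightarrow> 1" by simp
  qed simp
  moreover have "L \<longlonglongrightarrow> prodinf murm_alpha_factor * murm_kappa * Z"
  proof (rule Lim_transform_eventually[OF tendsto_mult[OF tendsto_mult[OF murm_alpha_factor_tendsto K_lim] Z_lim]])
    show "\<forall>\<^sub>F N in sequentially. (\<Prod>p\<in>primes_upto N. murm_alpha_factor p) *
      (\<Prod>p\<in>primes_upto N. \<Sum>j\<le>N. murm_local p j * (real p ^ j) powr -1) *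
      (\<Prod>p\<in>primes_upto N. \<Sum>j\<le>N. 1 * (real p ^ j) powr -2) = L N"
      using eventually_ge_at_top[of 2] by eventually_elim (rule eq)
  qed
  ultimately have "prodinf murm_alpha_factor * murm_kappa * Z = 1"
    by (rule LIMSEQ_unique[rotated])
  then show ?thesis unfolding murm_alpha_eq Z_def[symmetric] by (simp add: mult.assoc)
qed

lemma abs_summable_Suc_has_sum:
  fixes g :: "nat \<Rightarrow> real"
  assumes "summable (\<lambda>d. \<bar>g (Suc d)\<bar>)"
  shows "(g has_sum (\<Sum>d. g (Suc d))) {1..}"
  unfolding has_sum_Suc_iff[symmetric]
  by (intro norm_summable_imp_has_sum) (use assms in \<open>auto intro: summable_sums summable_rabs_cancel\<close>)

section \<open>Rearrangement of the sum over \<open>d\<close> by the divisor structure of Q\<close>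

context profile
begin

definition dilated_sum :: "real \<Rightarrow> real" where
  "dilated_sum Y = (\<Sum>b. H (Y / real (Suc b)) / (real (Suc b))\<^sup>2)"

lemma convolution_summable:
  assumes X: "X > 0"
  shows "(\<lambda>(a, b). murm_h a / (real a)\<^sup>2 * (H (X / real a / real b) / (real b)\<^sup>2)) summable_on ({1..} \<times> {1..})"
proof -
  define P where "P = (\<lambda>(a, b). \<bar>murm_h a\<bar> / (real a)\<^sup>2 * (C * (1 / (real b)\<^sup>2)))"
  have inv2: "(\<lambda>b. 1 / (real b)\<^sup>2) summable_on {1..}"
    using abs_summable_Suc_has_sum[of "\<lambda>b. 1 / (real b)\<^sup>2"] summable_Suc_inverse_square
    by (auto simp: summable_on_def)
  have normP: "norm (P (a, b)) = \<bar>murm_h a\<bar> / (real a)\<^sup>2 * (C * (1 / (real b)\<^sup>2))" for a b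
    using C_nonneg by (simp add: P_def abs_mult)
  have "(\<lambda>x. norm (P x)) summable_on ({1..} \<times> {1..})"
  proof (rule Infinite_Sum.abs_summable_on_Sigma_iff[THEN iffD2], intro conjI ballI)
    fix a :: nat
    show "(\<lambda>b. norm (P (a, b))) summable_on {1..}"
      unfolding normP by (intro summable_on_cmult_right inv2)
  next
    have "(\<Sum>\<^sub>\<infinity>b\<in>{1..}. norm (P (a, b))) = \<bar>murm_h a\<bar> / (real a)\<^sup>2 * (C * (\<Sum>\<^sub>\<infinity>b\<in>{1::nat..}. 1 / (real b)\<^sup>2))" for a
      unfolding normP infsum_cmult_right' ..
    then show "(\<lambda>a. norm (\<Sum>\<^sub>\<infinity>b\<in>{1..}. norm (P (a, b)))) summable_on {1..}"
      using summable_on_cmult_left[OF murm_h_summable(3),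
          of "\<bar>C * (\<Sum>\<^sub>\<infinity>b\<in>{1::nat..}. 1 / (real b)\<^sup>2)\<bar>"]
      by (simp only: real_norm_def abs_mult abs_divide abs_idempotent abs_power2)
  qed
  moreover have "norm (case x of (a, b) \<Rightarrow> murm_h a / (real a)\<^sup>2 * (H (X / real a / real b) / (real b)\<^sup>2)) \<le> norm (P x)"
    if "x \<in> {1..} \<times> {1..}" for x
  proof -
    obtain a b where x: "x = (a, b)" by (cases x)
    have "\<bar>H (X / real a / real b)\<bar> \<le> C" using X by (intro H_bound) auto
    then have "\<bar>murm_h a\<bar> / (real a)\<^sup>2 * (\<bar>H (X / real a / real b)\<bar> / (real b)\<^sup>2) \<le>
        \<bar>murm_h a\<bar> / (real a)\<^sup>2 * (C / (real b)\<^sup>2)"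
      by (intro mult_left_mono divide_right_mono) auto
    then show ?thesis using C_nonneg by (simp add: x P_def abs_mult)
  qed
  ultimately have "(\<lambda>x. norm (case x of (a, b) \<Rightarrow> murm_h a / (real a)\<^sup>2 *
      (H (X / real a / real b) / (real b)\<^sup>2))) summable_on ({1..} \<times> {1..})"
    by (rule Infinite_Sum.abs_summable_on_comparison_test)
  then show ?thesis by (rule abs_summable_summable)
qed

text \<open>One absolutely convergent double sum is read in two ways: grouped by n = a b it yields
  the coefficients Q(n), while summed over \<open>b\<close> first it yields dilated sums weighted by
  h(a) / a^2.\<close>

lemma convolution_rearrangement:
  assumes X: "X > 0"
  obtains T where
    "((\<lambda>n. murm_Q n * H (X / real n)) has_sum T) {1..}"
    "((\<lambda>a. murm_h a / (real a)\<^sup>2 * dilated_sum (X / real a)) has_sum T) {1..}"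
proof -
  define F where "F = (\<lambda>(a, b). murm_h a / (real a)\<^sup>2 * (H (X / real a / real b) / (real b)\<^sup>2))"
  obtain T where T: "(F has_sum T) ({1..} \<times> {1..})"
    using convolution_summable[OF X] unfolding F_def summable_on_def by blast
  have 1: "((\<lambda>a. murm_h a / (real a)\<^sup>2 * dilated_sum (X / real a)) has_sum T) {1..}"
  proof (rule has_sum_SigmaD[OF T])
    fix a :: nat
    have "((\<lambda>b. H (X / real a / real b) / (real b)\<^sup>2) has_sum dilated_sum (X / real a)) {1..}"
      unfolding dilated_sum_def
      by (intro abs_summable_Suc_has_sum summable_profile) (use X in simp)
    then show "((\<lambda>b. F (a, b)) has_sum murm_h a / (real a)\<^sup>2 * dilated_sum (X / real a)) {1..}"
      unfolding F_def by (simp only: prod.case has_sum_cmult_right)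
  qed
  define G where "G = (\<lambda>(n::nat, a). murm_h a / (real n)\<^sup>2 * H (X / real n))"
  \<comment> \<open>The pairs (n, a) with a dividing n correspond to (a, b) through b = n /
    a.\<close>
  have "(G has_sum T) (Sigma {1..} (\<lambda>n. {d. d dvd n})) \<longleftrightarrow> (F has_sum T) ({1..} \<times> {1..})"
  proof (rule has_sum_reindex_bij_witness[where j = "\<lambda>(n, a). (a, n div a)" and i = "\<lambda>(a, b). (a * b, a)"])
    fix x assume "x \<in> Sigma {1..} (\<lambda>n::nat. {d. d dvd n})"
    then obtain n a where x: "x = (n, a)" and n: "n > 0" and a: "a dvd n" by auto
    have an: "n = a * (n div a)" using a by simp
    have a0: "a > 0" "n div a > 0" using n a by (auto simp: div_greater_zero_iff dvd_imp_le intro: dvd_pos_nat)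
    show "(case case x of (n, a) \<Rightarrow> (a, n div a) of (a, b) \<Rightarrow> (a * b, a)) = x"
      using a by (simp add: x)
    show "(case x of (n, a) \<Rightarrow> (a, n div a)) \<in> {1..} \<times> {1..}"
      using a0 by (simp add: x)
    have rn: "real n = real a * real (n div a)" by (subst an) simp
    have e: "X / real a / real (n div a) = X / real n" "(real n)\<^sup>2 = (real a)\<^sup>2 * (real (n div a))\<^sup>2"
      by (simp_all add: rn power_mult_distrib)
    show "F (case x of (n, a) \<Rightarrow> (a, n div a)) = G x"
      unfolding x F_def G_def prod.case e by simp
  qed auto
  with T have T': "(G has_sum T) (Sigma {1..} (\<lambda>n. {d. d dvd n}))" by simp
  have 2: "((\<lambda>n. murm_Q n * H (X / real n)) has_sum T) {1..}"
  proof (rule has_sum_SigmaD[OF T'])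
    fix n :: nat assume "n \<in> {1..}"
    then have n: "n > 0" by simp
    have "murm_Q n * H (X / real n) = (\<Sum>d | d dvd n. G (n, d))"
      unfolding murm_Q_eq_sum[OF n] G_def by (simp add: sum_divide_distrib sum_distrib_right)
    then show "((\<lambda>d. G (n, d)) has_sum murm_Q n * H (X / real n)) {d. d dvd n}"
      using n by (intro has_sum_finiteI) auto
  qed
  show thesis by (rule that[OF 2 1])
qed

text \<open>Apply the one-variable estimate at X / a. The main terms h(a)/a^2 times I a / X add up
  to I \<kappa> / X, and the errors carry |h(a)| a^(-2 + 7/6), which is summable.\<close>

lemma murm_Q_profile_asymp:
  obtains K where "K \<ge> 0" "\<And>X. X > 0 \<Longrightarrow>
    \<bar>(\<Sum>d. murm_Q (Suc d) * H (X / real (Suc d))) - I * murm_kappa / X\<bar> \<le> K * X powr (- 7 / 6)"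
proof -
  obtain K where K: "\<And>Y. Y > 0 \<Longrightarrow> \<bar>dilated_sum Y - I / Y\<bar> \<le> K * Y powr (- 7 / 6)"
    using profile_sum_asymp unfolding dilated_sum_def by blast
  have K0: "K \<ge> 0" using K[of 1] by simp
  define A where "A = (\<Sum>\<^sub>\<infinity>a\<in>{1..}. \<bar>murm_h a\<bar> * real a powr (- 5 / 6))"
  have A: "((\<lambda>a. \<bar>murm_h a\<bar> * real a powr (- 5 / 6)) has_sum A) {1..}"
    unfolding A_def by (intro has_sum_infsum murm_h_powr_summable) simp
  show thesis
  proof (rule that)
    show "K * A \<ge> 0"
      using K0 unfolding A_def by (intro mult_nonneg_nonneg infsum_nonneg) auto
    fix X :: real assume X: "X > 0"
    obtain T where T: "((\<lambda>n. murm_Q n * H (X / real n)) has_sum T) {1..}"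
      "((\<lambda>a. murm_h a / (real a)\<^sup>2 * dilated_sum (X / real a)) has_sum T) {1..}"
      using convolution_rearrangement[OF X] by blast
    have T_eq: "(\<Sum>d. murm_Q (Suc d) * H (X / real (Suc d))) = T"
      using T(1) unfolding has_sum_Suc_iff[symmetric] by (rule has_sum_imp_sums[THEN sums_unique, symmetric])
    have "((\<lambda>a. I / X * (murm_h a / real a)) has_sum (I / X * murm_kappa)) {1..}"
      unfolding murm_kappa_def by (intro has_sum_cmult_right has_sum_infsum murm_h_summable)
    from has_sum_add[OF T(2) has_sum_uminusI[OF this]]
    have diff: "((\<lambda>a. murm_h a / (real a)\<^sup>2 * dilated_sum (X / real a) - I / X * (murm_h a / real a))
        has_sum (T - I / X * murm_kappa)) {1..}" by simp
    have "norm (T - I / X * murm_kappa) \<le> K * X powr (- 7 / 6) * A"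
    proof (rule norm_infsum_le[OF diff has_sum_cmult_right[OF A]])
      fix a :: nat assume "a \<in> {1..}"
      then have a: "real a > 0" by simp
      have "murm_h a / (real a)\<^sup>2 * dilated_sum (X / real a) - I / X * (murm_h a / real a) =
          murm_h a / (real a)\<^sup>2 * (dilated_sum (X / real a) - I / (X / real a))"
        using a X by (simp add: field_simps power2_eq_square)
      also have "norm \<dots> = \<bar>murm_h a\<bar> / (real a)\<^sup>2 * \<bar>dilated_sum (X / real a) - I / (X / real a)\<bar>"
        by (simp add: abs_mult)
      also have "\<dots> \<le> \<bar>murm_h a\<bar> / (real a)\<^sup>2 * (K * (X / real a) powr (- 7 / 6))"
        using a X by (intro mult_left_mono K) auto
      also have "(X / real a) powr (- 7 / 6) = X powr (- 7 / 6) * (real a)\<^sup>2 * real a powr (- 5 / 6)"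
      proof -
        have "(real a)\<^sup>2 * real a powr (- 5 / 6) = real a powr 2 * real a powr (- 5 / 6)"
          using a by (simp add: powr_numeral)
        also have "\<dots> = real a powr (7 / 6)" unfolding powr_add[symmetric] by simp
        finally have "(real a)\<^sup>2 * real a powr (- 5 / 6) * real a powr (- 7 / 6) = 1"
          using a by (simp flip: powr_add)
        then have "1 / real a powr (- 7 / 6) = (real a)\<^sup>2 * real a powr (- 5 / 6)"
          using a by (simp add: divide_eq_eq)
        moreover have "(X / real a) powr (- 7 / 6) = X powr (- 7 / 6) * (1 / real a powr (- 7 / 6))"
          by (simp add: powr_divide)
        ultimately show ?thesis by simp
      qed
      finally show "norm (murm_h a / (real a)\<^sup>2 * dilated_sum (X / real a) - I / X * (murm_h a / real a)) \<le>
          K * X powr (- 7 / 6) * (\<bar>murm_h a\<bar> * real a powr (- 5 / 6))"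
        using a by (simp add: mult_ac)
    qed
    then show "\<bar>(\<Sum>d. murm_Q (Suc d) * H (X / real (Suc d))) - I * murm_kappa / X\<bar> \<le> K * A * X powr (- 7 / 6)"
      unfolding T_eq by (simp add: mult_ac)
  qed
qed

end

section \<open>The murmuration density\<close>

lemma
  fixes f :: "nat \<Rightarrow> real \<Rightarrow> real"
  assumes cont: "\<And>n. continuous_on A (f n)"
    and bound: "\<And>n u. u \<in> A \<Longrightarrow> \<bar>f n u\<bar> \<le> M n" and M: "summable M"
  shows continuous_on_suminf_majorant: "continuous_on A (\<lambda>u. \<Sum>n. f n u)"
    and integral_suminf_majorant: "A = {a..b} \<Longrightarrow>
      (\<lambda>n. integral {a..b} (f n)) sums integral {a..b} (\<lambda>u. \<Sum>n. f n u)"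
proof -
  have lim: "uniform_limit A (\<lambda>n u. \<Sum>i<n. f i u) (\<lambda>u. \<Sum>n. f n u) sequentially"
    using bound M by (intro Weierstrass_m_test[where M = M]) auto
  have cont': "continuous_on A (\<lambda>u. \<Sum>i<n. f i u)" for n
    by (intro continuous_on_sum cont)
  show "continuous_on A (\<lambda>u. \<Sum>n. f n u)"
    by (rule uniform_limit_theorem[OF _ lim]) (use cont' in auto)
  assume A: "A = {a..b}"
  obtain I J where I: "\<And>n. ((\<lambda>u. \<Sum>i<n. f i u) has_integral I n) {a..b}"
    and J: "((\<lambda>u. \<Sum>n. f n u) has_integral J) {a..b}" and IJ: "I \<longlonglongrightarrow> J"
    using uniform_limit_integral[OF lim[unfolded A] cont'[unfolded A]] by auto
  have "I = (\<lambda>n. \<Sum>i<n. integral {a..b} (f i))"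
  proof
    fix n
    have "I n = integral {a..b} (\<lambda>u. \<Sum>i<n. f i u)" by (rule integral_unique[OF I, symmetric])
    also have "\<dots> = (\<Sum>i<n. integral {a..b} (f i))"
      using cont by (intro integral_sum integrable_continuous_interval) (auto simp: A)
    finally show "I n = (\<Sum>i<n. integral {a..b} (f i))" .
  qed
  then show "(\<lambda>n. integral {a..b} (f n)) sums integral {a..b} (\<lambda>u. \<Sum>n. f n u)"
    using IJ unfolding sums_def integral_unique[OF J] by simp
qed

section \<open>Convergence and continuity of the density\<close>

text \<open>The inner sum depends on \<open>s\<close> and \<open>y\<close> only through x = 4 pi s
  sqrt y; the factor 1 / s is left to \<open>murm_outer\<close>.\<close>

definition murm_inner :: "nat \<Rightarrow> real \<Rightarrow> real" where
  "murm_inner m x = (\<Sum>d. murm_Q (Suc d) * bessel_J m (x / real (Suc d)))"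

lemma murm_inner_majorant:
  obtains M where "summable M"
    "\<And>d x. x \<ge> 0 \<Longrightarrow> \<bar>murm_Q (Suc d) * bessel_J m (x / real (Suc d))\<bar> \<le> M d"
proof -
  obtain C where C: "\<And>x. x \<ge> 0 \<Longrightarrow> \<bar>bessel_J m x\<bar> \<le> C"
    using bessel_J_decay[of m] by metis
  obtain B where B: "B > 0" "\<And>n. n > 0 \<Longrightarrow> 0 \<le> murm_Q n" "\<And>n. n > 0 \<Longrightarrow> murm_Q n \<le> B / (real n)\<^sup>2"
    using murm_Q_bounds by blast
  show thesis
  proof (rule that)
    show "summable (\<lambda>d. B * C * (1 / (real (Suc d))\<^sup>2))"
      by (intro summable_mult summable_Suc_inverse_square)
    fix d and x :: real assume x: "x \<ge> 0"
    have "\<bar>murm_Q (Suc d)\<bar> * \<bar>bessel_J m (x / real (Suc d))\<bar> \<le> B / (real (Suc d))\<^sup>2 * C"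
      using x B(2,3)[of "Suc d"] B(1) by (intro mult_mono C) auto
    then show "\<bar>murm_Q (Suc d) * bessel_J m (x / real (Suc d))\<bar> \<le> B * C * (1 / (real (Suc d))\<^sup>2)"
      by (simp only: abs_mult) simp
  qed
qed

lemma murm_inner_summable:
  assumes "x \<ge> 0"
  shows "summable (\<lambda>d. murm_Q (Suc d) * bessel_J m (x / real (Suc d)))"
proof -
  obtain M where M: "summable M"
    "\<And>d x. x \<ge> 0 \<Longrightarrow> \<bar>murm_Q (Suc d) * bessel_J m (x / real (Suc d))\<bar> \<le> M d"
    using murm_inner_majorant[of m] by blast
  show ?thesis
    by (rule summable_comparison_test'[OF M(1), where N = 0]) (use M(2)[OF assms] in simp)
qed

lemma continuous_on_murm_inner: "continuous_on {0..} (murm_inner m)"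
proof -
  obtain M where "summable M"
    "\<And>d x. x \<ge> 0 \<Longrightarrow> \<bar>murm_Q (Suc d) * bessel_J m (x / real (Suc d))\<bar> \<le> M d"
    using murm_inner_majorant[of m] by blast
  then have "continuous_on {0..} (\<lambda>x. \<Sum>d. murm_Q (Suc d) * bessel_J m (x / real (Suc d)))"
    by (intro continuous_on_suminf_majorant[where M = M] continuous_intros) auto
  then show ?thesis by (simp add: murm_inner_def[abs_def])
qed

text \<open>The decay x^(-1/2) survives summation because Q(d) sqrt d = O(d^(-3/2)). It makes the
  terms of the outer sum O(s^(-3/2)), hence absolutely summable.\<close>

lemma murm_inner_decay:
  obtains C where "C > 0" "\<And>x. x \<ge> 0 \<Longrightarrow> sqrt x * \<bar>murm_inner m x\<bar> \<le> C"
proof -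
  obtain C where C: "C > 0" "\<And>x. x \<ge> 0 \<Longrightarrow> sqrt x * \<bar>bessel_J m x\<bar> \<le> C"
    using bessel_J_decay[of m] by metis
  obtain B where B: "B > 0" "\<And>n. n > 0 \<Longrightarrow> 0 \<le> murm_Q n" "\<And>n. n > 0 \<Longrightarrow> murm_Q n \<le> B / (real n)\<^sup>2"
    using murm_Q_bounds by blast
  define S where "S = (\<Sum>d. real (Suc d) powr (- 3 / 2))"
  have S: "summable (\<lambda>d. real (Suc d) powr (- 3 / 2))" by (intro summable_Suc_powr) simp
  have S0: "S \<ge> 0" unfolding S_def by (intro suminf_nonneg S) auto
  show thesis
  proof (rule that)
    \<comment> \<open>\<open>S\<close> is only known to be nonnegative here; the added 1 secures
      strict positivity.\<close>
    show "B * C * S + 1 > 0" using B(1) C(1) S0 by (intro add_nonneg_pos) auto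
    fix x :: real assume x: "x \<ge> 0"
    have bound: "\<bar>sqrt x * (murm_Q (Suc d) * bessel_J m (x / real (Suc d)))\<bar> \<le> B * C * real (Suc d) powr (- 3 / 2)" for d
    proof -
      define n where "n = real (Suc d)"
      have n: "n > 0" by (simp add: n_def)
      have "\<bar>sqrt x * (murm_Q (Suc d) * bessel_J m (x / n))\<bar> =
          murm_Q (Suc d) * sqrt n * (sqrt (x / n) * \<bar>bessel_J m (x / n)\<bar>)"
        using n x B(2)[of "Suc d"] by (simp add: abs_mult real_sqrt_divide)
      also have "\<dots> \<le> B / n\<^sup>2 * sqrt n * C"
        using B(2,3)[of "Suc d"] C x n B(1) by (intro mult_mono) (auto simp: n_def)
      also have "\<dots> = B * C * (sqrt n / n\<^sup>2)" by simp
      also have "sqrt n / n\<^sup>2 = n powr (1 / 2) / n powr 2"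
        using n by (simp add: powr_half_sqrt powr_numeral)
      also have "\<dots> = n powr (- 3 / 2)" unfolding powr_diff[symmetric] by simp
      finally show ?thesis by (simp add: n_def)
    qed
    have sm: "summable (\<lambda>d. B * C * real (Suc d) powr (- 3 / 2))" by (intro summable_mult S)
    have sn: "summable (\<lambda>d. \<bar>sqrt x * (murm_Q (Suc d) * bessel_J m (x / real (Suc d)))\<bar>)"
      by (rule summable_comparison_test'[OF sm, where N = 0]) (use bound in simp)
    have "sqrt x * murm_inner m x = (\<Sum>d. sqrt x * (murm_Q (Suc d) * bessel_J m (x / real (Suc d))))"
      unfolding murm_inner_def by (intro suminf_mult[symmetric] murm_inner_summable x)
    then have "sqrt x * \<bar>murm_inner m x\<bar> = \<bar>\<Sum>d. sqrt x * (murm_Q (Suc d) * bessel_J m (x / real (Suc d)))\<bar>"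
      using x by (metis abs_mult abs_of_nonneg real_sqrt_ge_zero)
    also have "\<dots> \<le> (\<Sum>d. \<bar>sqrt x * (murm_Q (Suc d) * bessel_J m (x / real (Suc d)))\<bar>)"
      by (rule summable_rabs[OF sn])
    also have "\<dots> \<le> (\<Sum>d. B * C * real (Suc d) powr (- 3 / 2))"
      by (intro suminf_le bound sn sm)
    also have "\<dots> = B * C * S" unfolding S_def by (intro suminf_mult S)
    finally show "sqrt x * \<bar>murm_inner m x\<bar> \<le> B * C * S + 1" by simp
  qed
qed

definition murm_outer :: "nat \<Rightarrow> real \<Rightarrow> real" where
  "murm_outer m T = (\<Sum>s. murm_inner m (4 * pi * real (Suc s) * T) / real (Suc s))"

lemma murm_eq_outer:
  assumes "y > 0"
  shows "murm k y = murm_alpha * sqrt y * murm_outer (k - 1) (sqrt y)"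
proof -
  have "(\<Sum>d. murm_Q (Suc d) / real (Suc s) * bessel_J (k - 1) (4 * pi * real (Suc s) * sqrt y / real (Suc d))) =
      murm_inner (k - 1) (4 * pi * real (Suc s) * sqrt y) / real (Suc s)" for s
  proof -
    have "(\<Sum>d. murm_Q (Suc d) * bessel_J (k - 1) (4 * pi * real (Suc s) * sqrt y / real (Suc d)) / real (Suc s)) =
        murm_inner (k - 1) (4 * pi * real (Suc s) * sqrt y) / real (Suc s)"
      unfolding murm_inner_def by (intro suminf_divide murm_inner_summable) (use assms in auto)
    then show ?thesis by (simp only: times_divide_eq_left)
  qed
  then show ?thesis using assms by (simp only: murm_def murm_outer_def if_True)
qed

lemma murm_outer_term_bound:
  assumes C: "\<And>x. x \<ge> 0 \<Longrightarrow> sqrt x * \<bar>murm_inner m x\<bar> \<le> C" and T: "T > 0"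
  shows "\<bar>murm_inner m (4 * pi * real (Suc s) * T) / real (Suc s)\<bar> \<le>
    C / sqrt T * real (Suc s) powr (- 3 / 2)"
proof -
  define n where "n = real (Suc s)"
  have n: "n > 0" by (simp add: n_def)
  \<comment> \<open>The factor 4 pi is at least 1 and is simply dropped.\<close>
  have "n * T \<le> 4 * pi * n * T" using pi_gt3 n T by simp
  then have "sqrt (n * T) * \<bar>murm_inner m (4 * pi * n * T)\<bar> \<le>
      sqrt (4 * pi * n * T) * \<bar>murm_inner m (4 * pi * n * T)\<bar>"
    by (intro mult_right_mono) auto
  also have "\<dots> \<le> C" using n T by (intro C) auto
  finally have "\<bar>murm_inner m (4 * pi * n * T)\<bar> \<le> C / (sqrt n * sqrt T)"
    using n T by (simp add: real_sqrt_mult field_simps)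
  then have "\<bar>murm_inner m (4 * pi * n * T)\<bar> / n \<le> C / (sqrt n * sqrt T) / n"
    using n by (intro divide_right_mono) auto
  also have "\<dots> = C / sqrt T * (1 / (sqrt n * n))" by simp
  also have "1 / (sqrt n * n) = n powr (- 3 / 2)"
  proof -
    have "sqrt n * n = n powr (1 / 2) * n powr 1" using n by (simp add: powr_half_sqrt)
    also have "\<dots> = n powr (3 / 2)" unfolding powr_add[symmetric] by simp
    finally show ?thesis using powr_minus_divide[of n "3 / 2"] by simp
  qed
  finally show ?thesis using n by (simp add: n_def)
qed

text \<open>Away from 0 the outer series converges uniformly. At 0 the outer sum grows at most like
  y^(-1/4), so the factor sqrt y leaves O(y^(1/4)), in agreement with the value 0 assigned
  there.\<close>

lemma continuous_on_murm: "continuous_on {0..} (murm k)"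
proof -
  define m where "m = k - 1"
  obtain C where C: "C > 0" "\<And>x. x \<ge> 0 \<Longrightarrow> sqrt x * \<bar>murm_inner m x\<bar> \<le> C"
    using murm_inner_decay[of m] by blast
  define S where "S = (\<Sum>s. real (Suc s) powr (- 3 / 2))"
  have S: "summable (\<lambda>s. real (Suc s) powr (- 3 / 2))" by (intro summable_Suc_powr) simp
  have outer_bound: "\<bar>murm_outer m T\<bar> \<le> C / sqrt T * S" if T: "T > 0" for T
  proof -
    note b = murm_outer_term_bound[OF C(2) T]
    have sm: "summable (\<lambda>s. C / sqrt T * real (Suc s) powr (- 3 / 2))" by (intro summable_mult S)
    have sn: "summable (\<lambda>s. \<bar>murm_inner m (4 * pi * real (Suc s) * T) / real (Suc s)\<bar>)"
      by (rule summable_comparison_test'[OF sm, where N = 0]) (use b in simp)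
    have "\<bar>murm_outer m T\<bar> \<le> (\<Sum>s. C / sqrt T * real (Suc s) powr (- 3 / 2))"
      unfolding murm_outer_def
      by (rule order.trans[OF summable_rabs[OF sn] suminf_le[OF b sn sm]])
    then show ?thesis unfolding S_def suminf_mult[OF S] .
  qed
  have outer_cont: "continuous_on {e..} (murm_outer m)" if e: "e > 0" for e
    unfolding murm_outer_def
  proof (rule continuous_on_suminf_majorant)
    show "summable (\<lambda>s. C / sqrt e * real (Suc s) powr (- 3 / 2))" by (intro summable_mult S)
    show "continuous_on {e..} (\<lambda>T. murm_inner m (4 * pi * real (Suc s) * T) / real (Suc s))" for s
      by (intro continuous_intros continuous_on_compose2[OF continuous_on_murm_inner])
        (use e in auto)
    fix s T assume T: "T \<in> {e..}"
    then have "C / sqrt T \<le> C / sqrt e" using e C(1) by (intro divide_left_mono) auto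
    then have "C / sqrt T * real (Suc s) powr (- 3 / 2) \<le> C / sqrt e * real (Suc s) powr (- 3 / 2)"
      by (intro mult_right_mono) auto
    then show "\<bar>murm_inner m (4 * pi * real (Suc s) * T) / real (Suc s)\<bar> \<le>
        C / sqrt e * real (Suc s) powr (- 3 / 2)"
      using murm_outer_term_bound[OF C(2), of T s] T e by simp
  qed
  have "continuous (at y within {0..}) (murm k)" if y: "y \<in> {0..}" for y
  proof (cases "y > 0")
    case True
    \<comment> \<open>The ray from y / 2 contains a neighbourhood of \<open>y\<close> and stays away
      from 0.\<close>
    have "continuous_on {y / 2..} (\<lambda>y. murm_alpha * sqrt y * murm_outer m (sqrt y))"
      by (intro continuous_intros continuous_on_compose2[OF outer_cont[of "sqrt (y / 2)"]])
        (use True in auto)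
    then have "continuous_on {y / 2<..} (\<lambda>y. murm_alpha * sqrt y * murm_outer m (sqrt y))"
      by (rule continuous_on_subset) auto
    then have "continuous_on {y / 2<..} (murm k)"
      by (rule continuous_on_cong[THEN iffD1, rotated 2]) (use True in \<open>auto simp: murm_eq_outer m_def\<close>)
    then have "isCont (murm k) y" using True by (simp add: continuous_on_eq_continuous_at)
    then show ?thesis by (rule continuous_at_imp_continuous_at_within)
  next
    case False
    then have y0: "y = 0" using y by simp
    have bound: "\<bar>murm k x\<bar> \<le> \<bar>murm_alpha\<bar> * (C * S) * sqrt (sqrt x)" if "x \<ge> 0" for x
    proof (cases "x > 0")
      case True
      have "\<bar>murm k x\<bar> = \<bar>murm_alpha\<bar> * sqrt x * \<bar>murm_outer m (sqrt x)\<bar>"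
        using True by (simp add: murm_eq_outer m_def abs_mult)
      also have "\<dots> \<le> \<bar>murm_alpha\<bar> * sqrt x * (C / sqrt (sqrt x) * S)"
        using True by (intro mult_left_mono outer_bound) auto
      also have "\<dots> = \<bar>murm_alpha\<bar> * (C * S) * (sqrt x / sqrt (sqrt x))" by simp
      also have "sqrt x / sqrt (sqrt x) = sqrt (sqrt x)" using True by (intro real_div_sqrt) simp
      finally show ?thesis .
    qed (use that in \<open>simp add: murm_def\<close>)
    have "continuous_on {0..} (\<lambda>x. \<bar>murm_alpha\<bar> * (C * S) * sqrt (sqrt x))"
      by (intro continuous_intros)
    then have "((\<lambda>x. \<bar>murm_alpha\<bar> * (C * S) * sqrt (sqrt x)) \<longlongrightarrow> 0) (at 0 within {0..})"
      unfolding continuous_on_def by (auto dest: bspec[of _ _ 0])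
    moreover have "\<forall>\<^sub>F x in at 0 within {0..}. norm (murm k x) \<le> \<bar>murm_alpha\<bar> * (C * S) * sqrt (sqrt x)"
      using bound by (simp add: eventually_at_filter)
    ultimately have "(murm k \<longlongrightarrow> 0) (at 0 within {0..})"
      by (rule Lim_null_comparison[rotated])
    moreover have "murm k 0 = 0" by (simp add: murm_def)
    ultimately show ?thesis unfolding y0 continuous_within by simp
  qed
  then show ?thesis by (simp add: continuous_on_eq_continuous_within)
qed

lemma continuous_on_murm_smooth: "continuous_on {0..} (murm_smooth k c)"
proof -
  have "continuous_on ({0..} \<times> cbox 1 c) (\<lambda>(y, u). murm k (y / u) * u)"
    unfolding split_beta
    by (intro continuous_intros continuous_on_compose2[OF continuous_on_murm]) auto
  then have "continuous_on {0..} (\<lambda>y. integral (cbox 1 c) (\<lambda>u. murm k (y / u) * u))"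
    by (rule integral_continuous_on_param)
  then have "continuous_on {0..} (\<lambda>y. integral {1..c} (\<lambda>u. murm k (y / u) * u) * inverse (integral {1..c} (\<lambda>u. u)))"
    by (intro continuous_on_mult_right) simp
  then show ?thesis by (simp add: murm_smooth_def[abs_def] divide_inverse)
qed

section \<open>Smoothing inside the double series, and the asymptotics\<close>

text \<open>A majorant uniform in \<open>u\<close> permits termwise integration, and averaging over
  \<open>u\<close> commutes with the dilation by \<open>d\<close>.\<close>

lemma murm_inner_smoothing:
  assumes c: "c \<ge> 1" and X: "X > 0"
  shows "integral {1..c} (\<lambda>u. sqrt u * murm_inner m (X / sqrt u)) =
    (\<Sum>d. murm_Q (Suc d) * smoothing c (1 / 2) (bessel_J m) (X / real (Suc d)))"
proof -
  obtain M where M: "summable M"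
    "\<And>d x. x \<ge> 0 \<Longrightarrow> \<bar>murm_Q (Suc d) * bessel_J m (x / real (Suc d))\<bar> \<le> M d"
    using murm_inner_majorant[of m] by blast
  let ?g = "\<lambda>d u. sqrt u * (murm_Q (Suc d) * bessel_J m (X / sqrt u / real (Suc d)))"
  have "(\<lambda>d. integral {1..c} (?g d)) sums integral {1..c} (\<lambda>u. \<Sum>d. ?g d u)"
  proof (rule integral_suminf_majorant[where A = "{1..c}" and M = "\<lambda>d. sqrt c * M d"])
    show "continuous_on {1..c} (?g d)" for d by (intro continuous_intros) auto
    show "summable (\<lambda>d. sqrt c * M d)" by (intro summable_mult M)
    fix d u assume u: "u \<in> {1..c}"
    show "\<bar>?g d u\<bar> \<le> sqrt c * M d"
      unfolding abs_mult[of "sqrt u"]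
      using u M(2)[of "X / sqrt u" d] X by (intro mult_mono) auto
  qed simp
  moreover have "integral {1..c} (\<lambda>u. \<Sum>d. ?g d u) = integral {1..c} (\<lambda>u. sqrt u * murm_inner m (X / sqrt u))"
    unfolding murm_inner_def using X
    by (intro integral_cong suminf_mult murm_inner_summable) auto
  moreover have "integral {1..c} (?g d) = murm_Q (Suc d) * smoothing c (1 / 2) (bessel_J m) (X / real (Suc d))" for d
  proof -
    have "integral {1..c} (?g d) =
        integral {1..c} (\<lambda>u. murm_Q (Suc d) * (u powr (1 / 2) * bessel_J m (X / real (Suc d) / sqrt u)))"
      by (intro integral_cong) (simp add: powr_half_sqrt mult_ac)
    then show ?thesis by (simp add: smoothing_def)
  qed
  ultimately show ?thesis by (simp only: sums_iff)
qed

lemma murm_smooth_eq: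
  assumes c: "c > 1" and y: "y > 0"
  shows "murm_smooth k c y * ((c\<^sup>2 - 1) / 2) = murm_alpha * sqrt y *
    (\<Sum>s. (\<Sum>d. murm_Q (Suc d) * smoothing c (1 / 2) (bessel_J (k - 1)) (4 * pi * real (Suc s) * sqrt y / real (Suc d)))
        / real (Suc s))"
proof -
  define m where "m = k - 1"
  obtain C where C: "C > 0" "\<And>x. x \<ge> 0 \<Longrightarrow> sqrt x * \<bar>murm_inner m x\<bar> \<le> C"
    using murm_inner_decay[of m] by blast
  have S: "summable (\<lambda>s. real (Suc s) powr (- 3 / 2))" by (intro summable_Suc_powr) simp
  let ?g = "\<lambda>s u. sqrt u * (murm_inner m (4 * pi * real (Suc s) * sqrt y / sqrt u) / real (Suc s))"
  have sums: "(\<lambda>s. integral {1..c} (?g s)) sums integral {1..c} (\<lambda>u. \<Sum>s. ?g s u)"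
  proof (rule integral_suminf_majorant[where A = "{1..c}" and
        M = "\<lambda>s. sqrt c * (C / sqrt (sqrt y / sqrt c) * real (Suc s) powr (- 3 / 2))"])
    show "continuous_on {1..c} (?g s)" for s
      by (intro continuous_intros continuous_on_compose2[OF continuous_on_murm_inner]) (use y in auto)
    show "summable (\<lambda>s. sqrt c * (C / sqrt (sqrt y / sqrt c) * real (Suc s) powr (- 3 / 2)))"
      by (intro summable_mult S)
    fix s u assume u: "u \<in> {1..c}"
    \<comment> \<open>Since u \<le> c, \<open>T\<close> stays above sqrt y / sqrt c, which makes the
      majorant independent of \<open>u\<close>.\<close>
    define T where "T = sqrt y / sqrt u"
    have T: "T > 0" "sqrt y / sqrt c \<le> T" using u y c by (auto simp: T_def intro!: divide_left_mono)
    have c0: "sqrt y / sqrt c > 0" using y c by simp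
    have "\<bar>murm_inner m (4 * pi * real (Suc s) * T) / real (Suc s)\<bar> \<le> C / sqrt T * real (Suc s) powr (- 3 / 2)"
      by (rule murm_outer_term_bound[OF C(2) T(1)])
    also have "\<dots> \<le> C / sqrt (sqrt y / sqrt c) * real (Suc s) powr (- 3 / 2)"
      using T c0 C(1) by (intro mult_right_mono divide_left_mono real_sqrt_le_mono mult_pos_pos) auto
    finally have "\<bar>sqrt u\<bar> * \<bar>murm_inner m (4 * pi * real (Suc s) * T) / real (Suc s)\<bar> \<le>
        sqrt c * (C / sqrt (sqrt y / sqrt c) * real (Suc s) powr (- 3 / 2))"
      using u by (intro mult_mono) auto
    moreover have "?g s u = sqrt u * (murm_inner m (4 * pi * real (Suc s) * T) / real (Suc s))"
      by (simp only: T_def times_divide_eq_right)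
    ultimately show "\<bar>?g s u\<bar> \<le> sqrt c * (C / sqrt (sqrt y / sqrt c) * real (Suc s) powr (- 3 / 2))"
      by (simp only: abs_mult[of "sqrt u"])
  qed simp
  have pointwise: "murm k (y / u) * u = murm_alpha * sqrt y * (\<Sum>s. ?g s u)" if u: "u \<in> {1..c}" for u
  proof -
    have T: "sqrt y / sqrt u > 0" using u y by simp
    have "summable (\<lambda>s. murm_inner m (4 * pi * real (Suc s) * (sqrt y / sqrt u)) / real (Suc s))"
      by (rule summable_comparison_test'[OF summable_mult[OF S], where N = 0])
        (unfold real_norm_def, rule murm_outer_term_bound[OF C(2) T])
    from suminf_mult[OF this, of "sqrt u"]
    have "(\<Sum>s. ?g s u) = sqrt u * murm_outer m (sqrt y / sqrt u)"
      by (simp only: murm_outer_def times_divide_eq_right)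
    moreover have "murm k (y / u) * u = murm_alpha * (sqrt (y / u) * u) * murm_outer m (sqrt y / sqrt u)"
      using u y by (simp add: murm_eq_outer m_def real_sqrt_divide)
    \<comment> \<open>Here the weight sqrt u arises, that is, the exponent 1/2 in
      \<open>smoothing\<close>.\<close>
    moreover have "sqrt (y / u) * u = sqrt y * sqrt u"
      using u y by (simp add: real_sqrt_divide field_simps)
    ultimately show ?thesis
      by (simp only: mult.assoc)
  qed
  have "integral {1..c} (?g s) =
      (\<Sum>d. murm_Q (Suc d) * smoothing c (1 / 2) (bessel_J m) (4 * pi * real (Suc s) * sqrt y / real (Suc d)))
        / real (Suc s)" for s
  proof -
    have "integral {1..c} (?g s) =
        integral {1..c} (\<lambda>u. sqrt u * murm_inner m (4 * pi * real (Suc s) * sqrt y / sqrt u)) / real (Suc s)"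
      by (subst integral_divide[symmetric]) (simp only: times_divide_eq_right)
    then show ?thesis using murm_inner_smoothing[of c "4 * pi * real (Suc s) * sqrt y" m] c y by simp
  qed
  then have "integral {1..c} (\<lambda>u. \<Sum>s. ?g s u) =
      (\<Sum>s. (\<Sum>d. murm_Q (Suc d) * smoothing c (1 / 2) (bessel_J m) (4 * pi * real (Suc s) * sqrt y / real (Suc d)))
        / real (Suc s))"
    using sums by (simp only: sums_iff)
  moreover have "integral {1..c} (\<lambda>u. murm k (y / u) * u) =
      murm_alpha * sqrt y * integral {1..c} (\<lambda>u. \<Sum>s. ?g s u)"
    unfolding integral_mult_right[symmetric] by (intro integral_cong pointwise)
  moreover have "(c\<^sup>2 - 1) / 2 \<noteq> 0" using c by (simp add: power2_eq_1_iff)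
  ultimately show ?thesis
    using integral_identity_Icc[of c] c by (simp add: murm_smooth_def m_def)
qed

text \<open>Writing k = 2j + 2 makes the Bessel order k - 1 = 2j + 1 odd, as
  \<open>smoothed_bessel_profile\<close> requires. The estimate for the sum over \<open>d\<close> is
  then summed over \<open>s\<close> at the points X s.\<close>

lemma murm_smooth_asymp:
  assumes c: "c > 1" and k: "k = 2 * j + 2"
  obtains K where "\<And>y. y > 0 \<Longrightarrow> \<bar>murm_smooth k c y - 1 / 2\<bar> \<le> K * y powr (- (1 / 12))"
proof -
  define H where "H = smoothing c (1 / 2) (bessel_J (2 * j + 1))"
  define I where "I = (c\<^sup>2 - 1) / 2"
  have I: "I > 0" using c by (simp add: I_def one_less_power)
  obtain \<Phi> H' C where "profile \<Phi> H H' I C"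
    using smoothed_bessel_profile[of c j] c unfolding H_def I_def profile_def by (metis less_imp_le)
  then interpret profile \<Phi> H H' I C .
  define D where "D X = (\<Sum>d. murm_Q (Suc d) * H (X / real (Suc d)))" for X
  obtain K where K0: "K \<ge> 0" and K: "\<And>X. X > 0 \<Longrightarrow> \<bar>D X - I * murm_kappa / X\<bar> \<le> K * X powr (- 7 / 6)"
    using murm_Q_profile_asymp unfolding D_def by blast
  define Z where "Z = (\<Sum>s. 1 / (real (Suc s))\<^sup>2)"
  define S where "S = (\<Sum>s. real (Suc s) powr (- 13 / 6))"
  have Ssum: "summable (\<lambda>s. real (Suc s) powr (- 13 / 6))" by (intro summable_Suc_powr) simp
  show thesis
  proof (rule that)
    fix y :: real assume y: "y > 0"
    define X where "X = 4 * pi * sqrt y"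
    have X: "X > 0" using y by (simp add: X_def)
    \<comment> \<open>The error of the s-th term, after removal of I \<kappa> / (X s^2); division by
      \<open>s\<close> turns s^(-7/6) into s^(-13/6).\<close>
    define E where "E s = D (4 * pi * real (Suc s) * sqrt y) / real (Suc s) - I * murm_kappa / X * (1 / (real (Suc s))\<^sup>2)" for s
    have E_bound: "\<bar>E s\<bar> \<le> K * X powr (- 7 / 6) * real (Suc s) powr (- 13 / 6)" for s
    proof -
      define n where "n = real (Suc s)"
      have n: "n > 0" by (simp add: n_def)
      have eq: "4 * pi * real (Suc s) * sqrt y = X * n" by (simp add: X_def n_def)
      have "E s = D (X * n) / n - I * murm_kappa / X * (1 / n\<^sup>2)"
        unfolding E_def eq by (simp only: n_def)
      also have "\<dots> = (D (X * n) - I * murm_kappa / (X * n)) / n"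
        using n X by (simp add: diff_divide_distrib power2_eq_square)
      finally have "E s = (D (X * n) - I * murm_kappa / (X * n)) / n" .
      then have "\<bar>E s\<bar> = \<bar>D (X * n) - I * murm_kappa / (X * n)\<bar> / n" using n by simp
      also have "\<dots> \<le> K * (X * n) powr (- 7 / 6) / n"
        using X n by (intro divide_right_mono K) auto
      also have "\<dots> = K * X powr (- 7 / 6) * (n powr (- 7 / 6) / n powr 1)"
        using n by (simp add: powr_mult)
      also have "n powr (- 7 / 6) / n powr 1 = n powr (- 13 / 6)"
        unfolding powr_diff[symmetric] by simp
      finally show ?thesis by (simp add: n_def)
    qed
    have sm: "summable (\<lambda>s. K * X powr (- 7 / 6) * real (Suc s) powr (- 13 / 6))"
      by (intro summable_mult Ssum)
    have Eabs: "summable (\<lambda>s. \<bar>E s\<bar>)"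
      by (rule summable_comparison_test'[OF sm, where N = 0]) (use E_bound in simp)
    have "\<bar>\<Sum>s. E s\<bar> \<le> (\<Sum>s. K * X powr (- 7 / 6) * real (Suc s) powr (- 13 / 6))"
      by (rule order.trans[OF summable_rabs[OF Eabs] suminf_le[OF E_bound Eabs sm]])
    also have "\<dots> = K * X powr (- 7 / 6) * S" unfolding S_def by (rule suminf_mult[OF Ssum])
    finally have E_sum: "\<bar>\<Sum>s. E s\<bar> \<le> K * S * X powr (- 7 / 6)" by (simp add: mult_ac)
    have "(\<lambda>s. E s + I * murm_kappa / X * (1 / (real (Suc s))\<^sup>2)) sums ((\<Sum>s. E s) + I * murm_kappa / X * Z)"
      unfolding Z_def
      by (intro sums_add sums_mult summable_sums summable_rabs_cancel[OF Eabs] summable_Suc_inverse_square)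
    then have "(\<Sum>s. D (4 * pi * real (Suc s) * sqrt y) / real (Suc s)) = (\<Sum>s. E s) + I * murm_kappa / X * Z"
      by (simp add: E_def sums_iff)
    moreover have "k - 1 = 2 * j + 1" using k by simp
    ultimately have main: "murm_smooth k c y * I = murm_alpha * sqrt y * ((\<Sum>s. E s) + I * murm_kappa / X * Z)"
      using murm_smooth_eq[OF c y, of k] by (simp only: D_def H_def I_def)
    \<comment> \<open>The constants give 2 pi, and sqrt y / X = 1 / (4 pi), whence the limit
      1/2.\<close>
    have "murm_alpha * sqrt y * (I * murm_kappa / X * Z) = (murm_alpha * murm_kappa * Z) * I * (sqrt y / X)"
      by simp
    also have "\<dots> = I / 2"
      using y unfolding murm_alpha_kappa_zeta2[folded Z_def] X_def by simp
    finally have "(murm_smooth k c y - 1 / 2) * I = murm_alpha * sqrt y * (\<Sum>s. E s)"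
      using main by (simp add: algebra_simps)
    then have "murm_smooth k c y - 1 / 2 = murm_alpha * sqrt y * (\<Sum>s. E s) / I"
      using I by (simp add: field_simps)
    then have "\<bar>murm_smooth k c y - 1 / 2\<bar> = \<bar>murm_alpha\<bar> * sqrt y * \<bar>\<Sum>s. E s\<bar> / I"
      using I y by (simp add: abs_mult)
    also have "\<dots> \<le> \<bar>murm_alpha\<bar> * sqrt y * (K * S * X powr (- 7 / 6)) / I"
      using I y by (intro divide_right_mono mult_left_mono E_sum) auto
    also have "\<dots> = \<bar>murm_alpha\<bar> * K * S * (4 * pi) powr (- 7 / 6) / I * (sqrt y * sqrt y powr (- 7 / 6))"
      by (simp add: X_def powr_mult)
    \<comment> \<open>The exponent is 1/2 - 7/12 = -1/12.\<close>
    also have "sqrt y * sqrt y powr (- 7 / 6) = y powr (- (1 / 12))"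
    proof -
      have "sqrt y * sqrt y powr (- 7 / 6) = y powr (1 / 2) * y powr (1 / 2 * (- 7 / 6))"
        using y unfolding powr_powr[symmetric] by (simp add: powr_half_sqrt)
      then show ?thesis unfolding powr_add[symmetric] by simp
    qed
    finally show "\<bar>murm_smooth k c y - 1 / 2\<bar> \<le>
        \<bar>murm_alpha\<bar> * K * S * (4 * pi) powr (- 7 / 6) / I * y powr (- (1 / 12))" .
  qed
qed

theorem theorem1p2:
  fixes k :: nat and c :: real
  assumes "c > 1" and "even k" and "k \<ge> 6"
  shows "continuous_on {0..} (murm_smooth k c) \<and>
         murm_smooth k c 0 = 0 \<and>
         (\<lambda>y. murm_smooth k c y - 1 / 2) \<in> O[at_top](\<lambda>y. y powr (- (1 / 12)))"
proof (intro conjI)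
  show "continuous_on {0..} (murm_smooth k c)" by (rule continuous_on_murm_smooth)
  show "murm_smooth k c 0 = 0" by (simp add: murm_smooth_def murm_def)
  \<comment> \<open>Evenness gives k = 2i, and k \<ge> 6 makes i positive, so i - 1 is a true
    subtraction on naturals.\<close>
  obtain j where "k = 2 * j + 2"
  proof -
    from assms(2) obtain i where "k = 2 * i" by (elim evenE)
    with assms(3) show thesis by (intro that[of "i - 1"]) simp
  qed
  then obtain K where K: "\<And>y. y > 0 \<Longrightarrow> \<bar>murm_smooth k c y - 1 / 2\<bar> \<le> K * y powr (- (1 / 12))"
    using murm_smooth_asymp[OF assms(1)] by blast
  show "(\<lambda>y. murm_smooth k c y - 1 / 2) \<in> O[at_top](\<lambda>y. y powr (- (1 / 12)))"
  proof (rule bigoI)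
    show "\<forall>\<^sub>F y in at_top. norm (murm_smooth k c y - 1 / 2) \<le> K * norm (y powr (- (1 / 12)))"
      using eventually_gt_at_top[of 0] by eventually_elim (use K in simp)
  qed
qed

end
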